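(* Let $\mu\in\mathbb N^\ell$ and let $\ell(\mu)$ be the number of nonzero entries of $\mu$. If $n\ge\ell(\mu)$ (with $n\ge2$), then the regular subgraph of the $\widehat{\mathfrak{sl}}_n$-crystal $\mathcal H^\mu$ is connected (as an undirected graph).
   Context: $\mathbb N=\{0,1,\dots\}$. $\mathcal H^\mu=\mathcal H^{1,\mu_\ell}\otimes\cdots\otimes\mathcal H^{1,\mu_1}$ is the set of $H=h_\ell\otimes\cdots\otimes h_1$ with $h_j$ a weakly increasing word of length $\mu_j$ over $\{1,\dots,n\}$, with operators $e_i,f_i:\mathcal H^\mu\to\mathcal H^\mu\sqcup\{\mathbf 0\}$, $0\le i\le n-1$, as follows. For $1\le i\le n-1$ take the word $w=h_\ell\cdots h_1$, replace each $i$ by ")" and each $i+1$ by "(", ignore other letters, and delete successively adjacent pairs "(" ")" until the remaining string is $)\cdots)(\cdots($. $e_i(H)$ changes the $i+1$ of the leftmost remaining "(" into $i$ ($e_i(H)=\mathbf 0$ if none); $f_i(H)$ changes the $i$ of the rightmost remaining ")" into $i+1$ ($\mathbf 0$ if none). For $i=0$ use the word obtained by reversing each $h_j$ before concatenating, with $n$ as ")" and $1$ as "("; $e_0$ changes a $1$ into $n$, $f_0$ changes an $n$ into $1$ by the same rule; words are re-sorted. The crystal graph has vertex set $\mathcal H^\mu$ and arrows $H\xrightarrow{i}f_i(H)$ whenever $f_i(H)\ne\mathbf 0$. Energy. For words $a,b$ of lengths $K\le L$: place the letters of $a$ as dots in a right column of boxes $1,\dots,n$ (top to bottom), those of $b$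 in a left column. Pair each right dot (any order) with the lowest unpaired left dot in a strictly higher box; if none exists, with the lowest unpaired left dot (a winding pair). Move the unpaired left dots to the same boxes of the right column; the right column is now $b'$, the left $a'$; $\mathcal R(a\otimes b)=b'\otimes a'$, $W(a\otimes b)$ = number of winding pairs. For $K>L$, $\mathcal R$ is the inverse of this map and $W(a\otimes b)=W(\mathcal R(a\otimes b))$. $\sigma_i$ applies $\mathcal R$ to the factors $h_{i+1}\otimes h_i$; $W_i(H)=W(h_{i+1}\otimes h_i)$. $D(H)=\sum_{1\le i<j\le\ell}W_i(\sigma_{i+1}\sigma_{i+2}\cdots\sigma_{j-1}(H))$. A $0$-arrow $H\to f_0(H)\neq\mathbf 0$ is regular if $D(f_0(H))=D(H)+1$. The regular subgraph of $\mathcal H^\mu$ is obtained from the crystal graph by removing all $0$-arrows that are not regular (all arrows with $1\le i\le n-1$ are kept). *)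

theory Defs
  imports "HOL-Library.Multiset" "Graph_Theory.Digraph_Component"
begin

(* An element H = h_l \<otimes> ... \<otimes> h_1 is represented by the list [h_1, ..., h_l], so H ! j is the factor
   h_(j+1), and all factor indices below are the customary ones shifted down by one.  The word of
   H reads the factors from the end of the list to its beginning. *)

type_synonym row_tensor = "nat list list"

definition row_words :: "nat \<Rightarrow> nat \<Rightarrow> nat list set" where
  "row_words n k = {w. length w = k \<and> sorted w \<and> set w \<subseteq> {1..n}}"

definition row_tensors :: "nat \<Rightarrow> nat list \<Rightarrow> row_tensor set" where
  "row_tensors n \<mu> = {H. length H = length \<mu> \<and> (\<forall>j<length \<mu>. H ! j \<in> row_words n (\<mu> ! j))}"


subsection \<open>Crystal operators\<close>

datatype bracket = Open | Close

(* Bracketing for i treats Suc i as an opening bracket (the letter 1 when i = 0) and the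
   following letter as a closing one. *)
definition closing_letter :: "nat \<Rightarrow> nat \<Rightarrow> nat" where
  "closing_letter n i = (if i = 0 then n else i)"

(* The pair (j, k) stands for the letter H ! j ! k. *)
definition reading_positions :: "nat \<Rightarrow> row_tensor \<Rightarrow> (nat \<times> nat) list" where
  "reading_positions i H =
     concat (map (\<lambda>j. map (Pair j) ((if i = 0 then rev else id) [0..<length (H ! j)]))
       (rev [0..<length H]))"

definition signature :: "nat \<Rightarrow> nat \<Rightarrow> row_tensor \<Rightarrow> (bracket \<times> nat \<times> nat) list" where
  "signature n i H =
     map (\<lambda>(j, k). (if H ! j ! k = Suc i then Open else Close, j, k))
       (filter (\<lambda>(j, k). H ! j ! k \<in> {closing_letter n i, Suc i}) (reading_positions i H))"

(* The deletions are carried out starting from the right; delete_pairs_reachable and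
   delete_pairs_shape state that this is a complete run of the deletion process. *)
fun delete_pairs :: "(bracket \<times> 'p) list \<Rightarrow> (bracket \<times> 'p) list" where
  "delete_pairs [] = []"
| "delete_pairs (x # xs) =
     (case delete_pairs xs of
        [] \<Rightarrow> [x]
      | y # ys \<Rightarrow> if fst x = Open \<and> fst y = Close then ys else x # y # ys)"

inductive deletion_step :: "(bracket \<times> 'p) list \<Rightarrow> (bracket \<times> 'p) list \<Rightarrow> bool" where
  "deletion_step (us @ [(Open, p), (Close, q)] @ vs) (us @ vs)"

lemma deletion_step_Cons: "deletion_step xs ys \<Longrightarrow> deletion_step (x # xs) (x # ys)"
  by (induction rule: deletion_step.induct) (metis append_Cons deletion_step.intros)

lemma delete_pairs_reachable: "deletion_step\<^sup>*\<^sup>* xs (delete_pairs xs)"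
proof (induction xs)
  case (Cons x xs)
  have 1: "deletion_step\<^sup>*\<^sup>* (x # xs) (x # delete_pairs xs)"
    using Cons by (induction rule: rtranclp_induct)
      (auto intro: rtranclp.rtrancl_into_rtrancl deletion_step_Cons)
  have "deletion_step (x # y # ys) ys" if "fst x = Open" "fst y = Close" for y ys
    using that deletion_step.intros[of "[]" "snd x" "snd y" ys] by (cases x; cases y) simp
  with 1 show ?case
    by (auto split: list.split intro: rtranclp.rtrancl_into_rtrancl)
qed simp

lemma delete_pairs_shape:
  "\<exists>cs os. delete_pairs xs = cs @ os \<and> (\<forall>x\<in>set cs. fst x = Close) \<and> (\<forall>x\<in>set os. fst x = Open)"
proof (induction xs)
  case (Cons x xs)
  then obtain cs os where h: "delete_pairs xs = cs @ os"
    "\<forall>x\<in>set cs. fst x = Close" "\<forall>x\<in>set os. fst x = Open" by blast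
  show ?case
  proof (cases "fst x")
    case Close
    with h show ?thesis
      by (intro exI[of _ "x # cs"] exI[of _ os]) (auto split: list.split)
  next
    case Open
    show ?thesis
    proof (cases cs)
      case Nil
      with h Open show ?thesis
        by (intro exI[of _ "[]"] exI[of _ "x # os"]) (auto split: list.split)
    next
      case (Cons c cs')
      with h Open show ?thesis
        by (intro exI[of _ "cs'"] exI[of _ os]) auto
    qed
  qed
qed simp

definition change_letter :: "nat \<times> nat \<Rightarrow> nat \<Rightarrow> row_tensor \<Rightarrow> row_tensor" where
  "change_letter = (\<lambda>(j, k) x H. H[j := sort ((H ! j)[k := x])])"

(* The value None plays the role of the extra element 0. *)
definition crystal_e :: "nat \<Rightarrow> nat \<Rightarrow> row_tensor \<Rightarrow> row_tensor option" where
  "crystal_e n i H =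
     (let os = filter (\<lambda>x. fst x = Open) (delete_pairs (signature n i H))
      in if os = [] then None else Some (change_letter (snd (hd os)) (closing_letter n i) H))"

definition crystal_f :: "nat \<Rightarrow> nat \<Rightarrow> row_tensor \<Rightarrow> row_tensor option" where
  "crystal_f n i H =
     (let cs = filter (\<lambda>x. fst x = Close) (delete_pairs (signature n i H))
      in if cs = [] then None else Some (change_letter (snd (last cs)) (Suc i) H))"


subsection \<open>Combinatorial R-matrix and energy\<close>

(* Boxes 1, ..., n run from top to bottom: "strictly higher" means a smaller letter and "lowest"
   means the largest letter.  In the four functions below the right column is the word being
   recursed on and B holds the left dots that are not yet paired. *)

definition winds :: "nat \<Rightarrow> nat list \<Rightarrow> bool" where
  "winds x B \<longleftrightarrow> \<not> (\<exists>y\<in>set B. y < x)"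

definition partner :: "nat \<Rightarrow> nat list \<Rightarrow> nat" where
  "partner x B = (if winds x B then Max (set B) else Max {y \<in> set B. y < x})"

fun paired_dots :: "nat list \<Rightarrow> nat list \<Rightarrow> nat list" where
  "paired_dots [] B = []"
| "paired_dots (x # a) B = partner x B # paired_dots a (remove1 (partner x B) B)"

fun unpaired_dots :: "nat list \<Rightarrow> nat list \<Rightarrow> nat list" where
  "unpaired_dots [] B = B"
| "unpaired_dots (x # a) B = unpaired_dots a (remove1 (partner x B) B)"

fun winding_pairs :: "nat list \<Rightarrow> nat list \<Rightarrow> nat" where
  "winding_pairs [] B = 0"
| "winding_pairs (x # a) B = of_bool (winds x B) + winding_pairs a (remove1 (partner x B) B)"

(* R and W in the case length a \<le> length b; a pair (a, b) stands for a \<otimes> b. *)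
definition R_short :: "nat list \<times> nat list \<Rightarrow> nat list \<times> nat list" where
  "R_short = (\<lambda>(a, b). (sort (a @ unpaired_dots a b), sort (paired_dots a b)))"

(* For length a > length b, R is the inverse of R_short on words over 1, ..., n. *)
definition R_matrix :: "nat \<Rightarrow> nat list \<times> nat list \<Rightarrow> nat list \<times> nat list" where
  "R_matrix n = (\<lambda>(a, b).
     if length a \<le> length b then R_short (a, b)
     else inv_into (row_words n (length b) \<times> row_words n (length a)) R_short (a, b))"

definition winding_count :: "nat \<Rightarrow> nat list \<times> nat list \<Rightarrow> nat" where
  "winding_count n = (\<lambda>(a, b).
     if length a \<le> length b then winding_pairs a b
     else case R_matrix n (a, b) of (c, d) \<Rightarrow> winding_pairs c d)"

definition sigma :: "nat \<Rightarrow> nat \<Rightarrow> row_tensor \<Rightarrow> row_tensor" where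
  "sigma n i H = (case R_matrix n (H ! Suc i, H ! i) of (c, d) \<Rightarrow> H[Suc i := c, i := d])"

definition local_energy :: "nat \<Rightarrow> nat \<Rightarrow> row_tensor \<Rightarrow> nat" where
  "local_energy n i H = winding_count n (H ! Suc i, H ! i)"

(* foldr (sigma n) [Suc i..<j] H applies sigma (j - 1) first and sigma (Suc i) last. *)
definition energy :: "nat \<Rightarrow> row_tensor \<Rightarrow> nat" where
  "energy n H =
     (\<Sum>j<length H. \<Sum>i<j. local_energy n i (foldr (sigma n) [Suc i..<j] H))"

(* The right dots may be processed in any order: this is pairing_any_order below. *)

lemma partner_eq:
  assumes "p \<in> set B" "p < x" "\<And>z. z \<in> set B \<Longrightarrow> z < x \<Longrightarrow> z \<le> p"
  shows "partner x B = p" "\<not> winds x B"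
  using assms by (auto simp: partner_def winds_def intro!: Max_eqI)

lemma partner_eq_winding:
  assumes "winds x B" "p \<in> set B" "\<And>z. z \<in> set B \<Longrightarrow> z \<le> p"
  shows "partner x B = p"
  using assms by (auto simp: partner_def intro!: Max_eqI)

lemma partner_props:
  assumes "B \<noteq> []"
  shows "partner x B \<in> set B"
    and "\<not> winds x B \<Longrightarrow> partner x B < x"
    and "\<not> winds x B \<Longrightarrow> z \<in> set B \<Longrightarrow> z < x \<Longrightarrow> z \<le> partner x B"
    and "winds x B \<Longrightarrow> z \<in> set B \<Longrightarrow> z \<le> partner x B"
proof -
  have *: "Max {y \<in> set B. y < x} \<in> {y \<in> set B. y < x}" if "\<not> winds x B"
    using that by (intro Max_in) (auto simp: winds_def)
  show "partner x B \<in> set B"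
    using * assms by (cases "winds x B") (auto simp: partner_def)
  show "\<not> winds x B \<Longrightarrow> partner x B < x"
    using * by (auto simp: partner_def)
  show "\<not> winds x B \<Longrightarrow> z \<in> set B \<Longrightarrow> z < x \<Longrightarrow> z \<le> partner x B"
    by (auto simp: partner_def)
  show "winds x B \<Longrightarrow> z \<in> set B \<Longrightarrow> z \<le> partner x B"
    by (auto simp: partner_def)
qed

lemma partner_remove_other:
  assumes "B \<noteq> []" "p \<noteq> partner x B"
  shows "partner x (remove1 p B) = partner x B" "winds x (remove1 p B) = winds x B"
proof -
  have sub: "set (remove1 p B) \<subseteq> set B" by (rule set_remove1_subset)
  have mem: "partner x B \<in> set (remove1 p B)"
    using partner_props(1)[OF assms(1)] assms(2) by (simp add: in_set_remove1)
  have "partner x (remove1 p B) = partner x B \<and> winds x (remove1 p B) = winds x B"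
  proof (cases "winds x B")
    case True
    then have w: "winds x (remove1 p B)" using sub by (auto simp: winds_def)
    then show ?thesis
      using True mem sub partner_props(4)[OF assms(1)] by (auto intro!: partner_eq_winding)
  next
    case False
    note p = partner_props(2)[OF assms(1) False] partner_props(3)[OF assms(1) False]
    show ?thesis
      using False partner_eq[OF mem p(1)] p(2) sub by blast
  qed
  then show "partner x (remove1 p B) = partner x B" "winds x (remove1 p B) = winds x B" by auto
qed

lemma partner_swap:
  assumes "x < y" "2 \<le> length B"
  defines "Bx \<equiv> remove1 (partner x B) B" and "By \<equiv> remove1 (partner y B) B"
  shows "remove1 (partner y Bx) Bx = remove1 (partner x By) By \<and>
    of_bool (winds x B) + of_bool (winds y Bx)
      = (of_bool (winds y B) + of_bool (winds x By) :: nat) \<and>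
    {#partner x B, partner y Bx#} = {#partner y B, partner x By#}"
proof (cases "partner x B = partner y B")
  case False
  have B: "B \<noteq> []" using assms by auto
  show ?thesis
    unfolding Bx_def By_def
    using partner_remove_other[OF B False] partner_remove_other[OF B False[symmetric]]
    by (simp add: remove1_commute add_mset_commute)
next
  case True
  define p C where "p = partner x B" and "C = remove1 p B"
  have B: "B \<noteq> []" using assms by auto
  have p: "p = partner y B" using True p_def by simp
  have CC: "Bx = C" "By = C" using True by (simp_all add: Bx_def By_def C_def p_def)
  have "p \<in> set B" using partner_props(1)[OF B] p_def by simp
  then have C: "C \<noteq> []" using assms(2)
    by (metis C_def One_nat_def Suc_1 Suc_le_lessD diff_is_0_eq leD length_0_conv length_remove1)
  have sub: "set C \<subseteq> set B" unfolding C_def by (rule set_remove1_subset)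
  have "partner y C = partner x C \<and>
    of_bool (winds x B) + of_bool (winds y C)
      = (of_bool (winds y B) + of_bool (winds x C) :: nat)"
  proof (cases "winds x B")
    case False
    then have "p < x" using partner_props(2)[OF B] p_def by blast
    have wy: "\<not> winds y B" using False assms(1) unfolding winds_def by (meson order.strict_trans)
    have "z < x \<longleftrightarrow> z < y" if "z \<in> set C" for z
      using partner_props(3)[OF B wy, of z] \<open>p < x\<close> p sub that assms(1) by auto
    then have "winds x C = winds y C" "{z \<in> set C. z < x} = {z \<in> set C. z < y}"
      by (auto simp: winds_def)
    with False wy show ?thesis by (simp add: partner_def)
  next
    case wx: True
    then have wxC: "winds x C" using sub by (auto simp: winds_def)
    show ?thesis
    proof (cases "winds y B")
      case wy: True
      then have "winds y C" using sub by (auto simp: winds_def)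
      with wx wxC wy show ?thesis by (simp add: partner_def)
    next
      case wy: False
      then have "p < y" using partner_props(2)[OF B] p by blast
      then have lt: "z < y" if "z \<in> set C" for z
        using partner_props(4)[OF B wx, of z] that sub p_def by auto
      then have "\<not> winds y C" "{z \<in> set C. z < y} = set C"
        using C by (auto simp: winds_def neq_Nil_conv)
      with wx wxC wy show ?thesis by (simp add: partner_def)
    qed
  qed
  then show ?thesis using CC p p_def by simp
qed

definition pairing_result :: "nat list \<Rightarrow> nat list \<Rightarrow> nat list \<times> nat \<times> nat multiset" where
  "pairing_result a B = (unpaired_dots a B, winding_pairs a B, mset (paired_dots a B))"

lemma pairing_result_Cons:
  "pairing_result (x # a) B =
     (case pairing_result a (remove1 (partner x B) B) of
        (u, w, p) \<Rightarrow> (u, of_bool (winds x B) + w, add_mset (partner x B) p))"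
  by (simp add: pairing_result_def)

lemma pairing_result_swap:
  assumes "2 \<le> length B"
  shows "pairing_result (x # y # a) B = pairing_result (y # x # a) B"
proof -
  have *: "pairing_result (x # y # a) B = pairing_result (y # x # a) B" if "x < y" for x y
  proof -
    let ?Bx = "remove1 (partner x B) B" and ?By = "remove1 (partner y B) B"
    have swap: "remove1 (partner y ?Bx) ?Bx = remove1 (partner x ?By) ?By"
      "of_bool (winds x B) + of_bool (winds y ?Bx)
        = (of_bool (winds y B) + of_bool (winds x ?By) :: nat)"
      "{#partner x B, partner y ?Bx#} = {#partner y B, partner x ?By#}"
      using partner_swap[OF that assms] by blast+
    obtain u w p where r: "pairing_result a (remove1 (partner x ?By) ?By) = (u, w, p)"
      by (metis prod_cases3)
    have "add_mset (partner x B) (add_mset (partner y ?Bx) p)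
        = add_mset (partner y B) (add_mset (partner x ?By) p)"
      using arg_cong[OF swap(3), of "\<lambda>m. m + p"] by simp
    with swap(2) show ?thesis
      by (simp only: pairing_result_Cons swap(1) r prod.case add.assoc[symmetric])
  qed
  show ?thesis using *[of x y] *[of y x] by (cases x y rule: linorder_cases) auto
qed

lemma length_remove1_partner: "B \<noteq> [] \<Longrightarrow> length (remove1 (partner x B) B) = length B - 1"
  by (simp add: length_remove1 partner_props(1))

lemma pairing_result_move:
  assumes "x \<in> set a" "length a \<le> length B"
  shows "pairing_result a B = pairing_result (x # remove1 x a) B"
  using assms
proof (induction a arbitrary: B)
  case (Cons y a)
  show ?case
  proof (cases "x = y")
    case False
    with Cons.prems have x: "x \<in> set a" "B \<noteq> []" by auto
    then have "2 \<le> length B" using Cons.prems by (cases a) auto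
    moreover have "length a \<le> length (remove1 (partner y B) B)"
      using Cons.prems x by (simp add: length_remove1_partner)
    then have "pairing_result (y # a) B = pairing_result (y # x # remove1 x a) B"
      using Cons.IH[OF x(1)] by (simp only: pairing_result_Cons)
    ultimately show ?thesis using False pairing_result_swap by simp
  qed simp
qed simp

lemma pairing_any_order:
  assumes "mset a = mset a'" "length a \<le> length B"
  shows "pairing_result a B = pairing_result a' B"
  using assms
proof (induction a arbitrary: a' B)
  case (Cons x a)
  have x: "x \<in> set a'" using Cons.prems(1) by (metis list.set_intros(1) mset_eq_setD)
  have "mset a = mset (remove1 x a')" using Cons.prems(1)
    by (metis add_mset_remove_trivial mset.simps(2) mset_remove1)
  moreover have "length a \<le> length (remove1 (partner x B) B)"
    using Cons.prems(2) by (subst length_remove1_partner) auto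
  ultimately have "pairing_result (x # a) B = pairing_result (x # remove1 x a') B"
    using Cons.IH by (simp only: pairing_result_Cons)
  also have "\<dots> = pairing_result a' B"
    using pairing_result_move[OF x] Cons.prems by (metis mset_eq_length)
  finally show ?case .
qed simp


subsection \<open>The crystal graph and its regular subgraph\<close>

(* An arrow is a triple (H, i, H') with H' = f_i(H). *)
definition crystal_graph :: "nat \<Rightarrow> nat list \<Rightarrow> (row_tensor, row_tensor \<times> nat \<times> row_tensor) pre_digraph"
  where
  "crystal_graph n \<mu> =
     \<lparr>verts = row_tensors n \<mu>,
      arcs = {(H, i, H'). H \<in> row_tensors n \<mu> \<and> i < n \<and> crystal_f n i H = Some H'},
      tail = (\<lambda>(H, i, H'). H),
      head = (\<lambda>(H, i, H'). H')\<rparr>"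

definition regular_subgraph :: "nat \<Rightarrow> nat list \<Rightarrow> (row_tensor, row_tensor \<times> nat \<times> row_tensor) pre_digraph"
  where
  "regular_subgraph n \<mu> =
     crystal_graph n \<mu>
       \<lparr>arcs := {(H, i, H') \<in> arcs (crystal_graph n \<mu>). i = 0 \<longrightarrow> energy n H' = energy n H + 1}\<rparr>"

end

(* A pair a \<otimes> b with a not longer than b is read as a stationary cyclic queue: going up through the
   boxes, the letters of a are customers and those of b are services, and R exchanges arrivals and
   departures.  A crystal operator changes the queue length at a single place, which shows that R
   commutes with all crystal operators, and the queue length at 0 is the winding number.  Hence, while
   h_j is moved to the right end, the changes of the winding numbers under f_0 telescope, and the arrow
   is regular as soon as f_0 never acts on the rightmost factor after such a move.

   A highest weight element has only letters 1 in the moved factors.  If its letters are 1, ..., n, then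
   n \<ge> l(\<mu>) forces all letters n into the last nonempty factor, so that f_0 acts and is regular.
   Otherwise, repeatedly replacing a letter t by an absent letter t + 1 leads, inside the classical
   component, to an element with letters n and without letters 1 whose moved factors are powers of a
   letter less than n; again f_0 acts and is regular.  The energy, constant on classical components,
   grows along such arrows, so every path ends in the highest weight element with only letters 1. *)

theory Submission
  imports Defs
begin

text \<open>Two definitions resist direct reasoning: the pairing treats the dots one at a time, and
  R on a longer left word is given only as an inverse. Both are replaced by one periodic recursion
  on letter counts whose admissible solution is unique. To show that R commutes with an operation it
  then suffices to exhibit the changed queue, and a longer left word means the same queue read from
  output to input.

  The obstacle to regularity is that a winding is lost when f_0 hits the right end after a move, so
  the moved factor must be known to contain no letter n. For a highest weight element it is known:
  nothing is read after the rightmost factor, so a letter above 1 there would stay unmatched. But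
  such an element may have no unmatched letter n, and then f_0 gives 0. Replacing letters by absent
  neighbours creates letters n while the moved factors stay under control; what has to be carried
  along is that their only letter is smaller than some letter of the element.\<close>

subsection \<open>Periodic queues\<close>

text \<open>\<open>q x\<close> counts the pairs of dots whose connecting arc, running cyclically upwards from the right
  dot, passes from box \<open>x + 1\<close> to box \<open>x\<close>.  The last conjunct selects the minimal solution, which is only
  needed for words of equal length.\<close>

definition qsol ::
    "nat \<Rightarrow> (nat \<Rightarrow> nat) \<Rightarrow> (nat \<Rightarrow> nat) \<Rightarrow> (nat \<Rightarrow> nat) \<Rightarrow> (nat \<Rightarrow> nat) \<Rightarrow> (nat \<Rightarrow> nat) \<Rightarrow> bool" where
  "qsol n a b c d q \<longleftrightarrow> q 0 = q n \<and>
     (\<forall>x\<in>{1..n}. q (x - 1) = (q x - b x) + a x \<and> c x = a x + (b x - q x) \<and> d x = min (q x) (b x)) \<and>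
     (\<exists>x\<in>{1..n}. q x \<le> b x)"

text \<open>At a box where \<open>f\<close> empties its queue, \<open>f (x - 1)\<close> is just
  \<open>a x\<close>, which bounds every solution from below. The recursion is monotone in the queue
  length, so the inequality travels up to 0, passes to \<open>n\<close> by periodicity and reaches
  every place.\<close>

lemma queue_minimal:
  fixes f g a b :: "nat \<Rightarrow> nat"
  assumes f: "f 0 = f n" "\<And>x. x \<in> {1..n} \<Longrightarrow> f (x - 1) = (f x - b x) + a x"
    and g: "g 0 = g n" "\<And>x. x \<in> {1..n} \<Longrightarrow> g (x - 1) = (g x - b x) + a x"
    and x: "x \<in> {1..n}" "f x \<le> b x"
    and y: "y \<le> n"
  shows "f y \<le> g y"
proof -
  have step: "f (y - 1) \<le> g (y - 1)" if "y \<in> {1..n}" "f y \<le> g y" for y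
    using f(2)[OF that(1)] g(2)[OF that(1)] that(2) by simp
  have down: "f z \<le> g z" if "z \<le> y" "y \<le> n" "f y \<le> g y" for y z
    using that
  proof (induction rule: inc_induct)
    case (step m)
    then show ?case using \<open>\<And>y. y \<in> {1..n} \<Longrightarrow> f y \<le> g y \<Longrightarrow> f (y - 1) \<le> g (y - 1)\<close>[of "Suc m"]
      by simp
  qed simp
  have "f (x - 1) \<le> g (x - 1)" using f(2)[OF x(1)] g(2)[OF x(1)] x(2) by simp
  then have "f 0 \<le> g 0" using down[of 0 "x - 1"] x(1) by force
  then show ?thesis using down[of y n] y f(1) g(1) by simp
qed

lemma qsol_unique:
  assumes "qsol n a b c d q" "qsol n a b c' d' q'"
  shows "y \<le> n \<Longrightarrow> q y = q' y"
    and "x \<in> {1..n} \<Longrightarrow> c x = c' x"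
    and "x \<in> {1..n} \<Longrightarrow> d x = d' x"
proof -
  have eq: "q y = q' y" if "y \<le> n" for y
  proof (rule antisym)
    show "q y \<le> q' y"
      using assms that unfolding qsol_def by (blast intro: queue_minimal[of q n b a q'])
    show "q' y \<le> q y"
      using assms that unfolding qsol_def by (blast intro: queue_minimal[of q' n b a q])
  qed
  show "y \<le> n \<Longrightarrow> q y = q' y" by (rule eq)
  show "x \<in> {1..n} \<Longrightarrow> c x = c' x" "x \<in> {1..n} \<Longrightarrow> d x = d' x"
    using assms eq[of x] unfolding qsol_def by auto
qed

text \<open>This is the queue run backwards: \<open>d\<close> arrives, \<open>c\<close> serves, and
  \<open>a\<close> counts those served. By the last equivalence a box that empties its queue does so
  in the reversed queue too, so minimality survives reversal.\<close>

lemma qsol_reverse: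
  assumes "qsol n a b c d q" "x \<in> {1..n}"
  shows "q x = (q (x - 1) - c x) + d x" "a x = min (q (x - 1)) (c x)" "b x = d x + (c x - a x)"
    "q x \<le> b x \<longleftrightarrow> q (x - 1) \<le> c x"
proof -
  have h: "q (x - 1) = (q x - b x) + a x" "c x = a x + (b x - q x)" "d x = min (q x) (b x)"
    using assms unfolding qsol_def by auto
  show "q x = (q (x - 1) - c x) + d x" "a x = min (q (x - 1)) (c x)" "b x = d x + (c x - a x)"
    "q x \<le> b x \<longleftrightarrow> q (x - 1) \<le> c x"
    unfolding h by auto
qed

text \<open>Reflecting \<open>x \<mapsto> n - x\<close> turns the recursion in \<open>qsol_reverse\<close> into that of a queue.\<close>

lemma qsol_reverse_unique:
  assumes "qsol n a b c d q" "qsol n a' b' c d q'"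
  shows "y \<le> n \<Longrightarrow> q y = q' y"
    and "x \<in> {1..n} \<Longrightarrow> a x = a' x"
    and "x \<in> {1..n} \<Longrightarrow> b x = b' x"
proof -
  have le: "q y \<le> q' y" if sol: "qsol n a b c d q" "qsol n a' b' c d q'" and y: "y \<le> n" for a b q a' b' q' y
  proof -
    obtain x where x: "x \<in> {1..n}" "q x \<le> b x" using sol unfolding qsol_def by auto
    \<comment> \<open>Queue lengths live on the places 0, ..., n between boxes and reflect by n - z,
      whereas boxes reflect by n + 1 - z.\<close>
    have rec: "q (n - (z - 1)) = (q (n - z) - c (n + 1 - z)) + d (n + 1 - z)"
      if "qsol n a b c d q" "z \<in> {1..n}" for a b q z
    proof -
      have "n + 1 - z \<in> {1..n}" "n - (z - 1) = n + 1 - z" "n + 1 - z - 1 = n - z" using that(2) by auto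
      then show ?thesis using qsol_reverse(1)[OF that(1), of "n + 1 - z"] by simp
    qed
    have "q (n - (n - y)) \<le> q' (n - (n - y))"
    proof (rule queue_minimal[where f = "\<lambda>z. q (n - z)" and g = "\<lambda>z. q' (n - z)" and n = n
          and b = "\<lambda>z. c (n + 1 - z)" and a = "\<lambda>z. d (n + 1 - z)" and x = "n + 1 - x"])
      show "q (n - 0) = q (n - n)" "q' (n - 0) = q' (n - n)" using sol unfolding qsol_def by simp_all
      show "q (n - (n + 1 - x)) \<le> c (n + 1 - (n + 1 - x))"
        using qsol_reverse(4)[OF sol(1) x(1)] x by (simp add: Suc_diff_le)
    qed (use rec sol x in auto)
    then show ?thesis using y by simp
  qed
  have eq: "q y = q' y" if "y \<le> n" for y
    using le[OF assms that] le[OF assms(2,1) that] by (rule antisym)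
  show "y \<le> n \<Longrightarrow> q y = q' y" by (rule eq)
  assume x: "x \<in> {1..n}"
  show "a x = a' x"
    using qsol_reverse(2)[OF assms(1) x] qsol_reverse(2)[OF assms(2) x] eq[of "x - 1"] x by force
  then show "b x = b' x"
    using qsol_reverse(3)[OF assms(1) x] qsol_reverse(3)[OF assms(2) x] by simp
qed

lemma qsol_content:
  assumes "qsol n a b c d q" "x \<in> {1..n}"
  shows "c x + d x = a x + b x"
  using assms unfolding qsol_def by auto

section \<open>Brackets and raising operators on a queue\<close>

lemma closing_letter_bounds:
  assumes "2 \<le> n" "i < n"
  shows "closing_letter n i \<in> {1..n}" "Suc i \<in> {1..n}" "closing_letter n i \<noteq> Suc i"
  using assms by (auto simp: closing_letter_def)

lemma qsol_at:
  assumes "qsol n a b c d q" "2 \<le> n" "i < n" "k = closing_letter n i"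
  shows "q k = q i" "q i = (q (Suc i) - b (Suc i)) + a (Suc i)" 
    "c (Suc i) = a (Suc i) + (b (Suc i) - q (Suc i))" "d (Suc i) = min (q (Suc i)) (b (Suc i))"
    "q (k - 1) = (q i - b k) + a k" "c k = a k + (b k - q i)" "d k = min (q i) (b k)"
proof -
  note k = closing_letter_bounds[OF assms(2,3), folded assms(4)]
  show *: "q k = q i" using assms by (auto simp: qsol_def closing_letter_def)
  show "q i = (q (Suc i) - b (Suc i)) + a (Suc i)" 
    "c (Suc i) = a (Suc i) + (b (Suc i) - q (Suc i))" "d (Suc i) = min (q (Suc i)) (b (Suc i))"
    using assms(1) k(2) unfolding qsol_def by fastforce+
  show "q (k - 1) = (q i - b k) + a k" "c k = a k + (b k - q i)" "d k = min (q i) (b k)"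
    unfolding *[symmetric] using assms(1) k(1) unfolding qsol_def by auto
qed

text \<open>The boxes \<open>k\<close> and \<open>Suc i\<close> are cyclic neighbours tied together
  by the single queue length \<open>q i\<close>; splitting on whether each of them empties its queue
  leaves linear arithmetic. The expressions count the unmatched closing and opening brackets of a
  word of two factors, left factor first.\<close>

lemma qsol_signature:
  assumes "qsol n a b c d q" "2 \<le> n" "i < n" "k = closing_letter n i"
  shows "c k + (d k - c (Suc i)) = a k + (b k - a (Suc i))"
    "d (Suc i) + (c (Suc i) - d k) = b (Suc i) + (a (Suc i) - b k)"
proof -
  note at = qsol_at[OF assms]
  show "c k + (d k - c (Suc i)) = a k + (b k - a (Suc i))"
    unfolding at(3,6,7) using at(2)
    by (cases "q (Suc i) \<le> b (Suc i)"; cases "q i \<le> b k") auto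
  show "d (Suc i) + (c (Suc i) - d k) = b (Suc i) + (a (Suc i) - b k)"
    unfolding at(3,4,7) using at(2)
    by (cases "q (Suc i) \<le> b (Suc i)"; cases "q i \<le> b k") auto
qed

definition raise_counts :: "nat \<Rightarrow> nat \<Rightarrow> (nat \<Rightarrow> nat) \<Rightarrow> nat \<Rightarrow> nat" where
  "raise_counts k m a = a(k := a k - 1, m := a m + 1)"

text \<open>Count version of the commutation of R with f_i. By the bracket rule, \<open>ba\<close>
  and \<open>bc\<close> say that f_i acts on the right factor before and after R, and the positivity
  assumption says that f_i does not give 0. A letter moves between neighbouring boxes, so only the
  queue length between them can change.\<close>

lemma qsol_raise:
  assumes "qsol n a b c d q" "2 \<le> n" "i < n" "k = closing_letter n i"
    and "0 < a k + (b k - a (Suc i))"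
  defines "ba \<equiv> a (Suc i) < b k" and "bc \<equiv> c (Suc i) < d k"
  defines "r \<equiv> raise_counts k (Suc i)"
  shows "\<exists>q'. qsol n (if ba then a else r a) (if ba then r b else b)
      (if bc then c else r c) (if bc then r d else d) q' \<and>
    int (q' 0) = int (q 0) + of_bool (i = 0) * (of_bool (\<not> ba) - of_bool bc)"
proof -
  note k = closing_letter_bounds[OF assms(2,3), folded assms(4)]
  note at = qsol_at[OF assms(1-4)]
  \<comment> \<open>The value forced by the recursion at box \<open>Suc i\<close> with the raised
    counts and the old \<open>q (Suc i)\<close>.\<close>
  define v where "v = (q (Suc i) - (if ba then b (Suc i) + 1 else b (Suc i))) +
     (if ba then a (Suc i) else a (Suc i) + 1)"
  \<comment> \<open>The two updates coincide for \<open>0 < i\<close>; for \<open>i = 0\<close> they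
    are the two ends \<open>n\<close> and 0 of the cycle, which must stay equal.\<close>
  define q' where "q' = q(k := v, i := v)"
  have q': "q' k = v" "q' i = v" "q' (Suc i) = q (Suc i)" "q' (k - 1) = q (k - 1)"
    using k assms(2-4) by (auto simp: q'_def closing_letter_def)
  have other: "q' (x - 1) = q (x - 1)" "q' x = q x" if "x \<in> {1..n}" "x \<noteq> k" "x \<noteq> Suc i" for x
    using that assms(2-4) by (auto simp: q'_def closing_letter_def split: if_splits)
  \<comment> \<open>In particular \<open>bc\<close> implies \<open>ba\<close>, so three cases
    remain, in which \<open>q i\<close> changes by +1, 0 or -1.\<close>
  have bc: "bc \<longleftrightarrow> b (Suc i) < q (Suc i) \<and> ba"
    unfolding bc_def ba_def at(3,7) using at(2) by (cases "q (Suc i) \<le> b (Suc i)") auto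
  have v: "v = (if ba then if bc then q i - 1 else q i else q i + 1)"
    using at(2) by (auto simp: v_def bc)
  have "int v = int (q i) + of_bool (\<not> ba) - of_bool bc"
    using at(2) by (auto simp: v bc)
  moreover have "q' 0 = (if i = 0 then v else q 0)"
    using assms(3,4) k(1) by (auto simp: q'_def closing_letter_def)
  ultimately have e: "int (q' 0) = int (q 0) + of_bool (i = 0) * (of_bool (\<not> ba) - of_bool bc)"
    by auto
  let ?a = "if ba then a else r a" and ?b = "if ba then r b else b"
    and ?c = "if bc then c else r c" and ?d = "if bc then r d else d"
  have r: "r f k = f k - 1" "r f (Suc i) = f (Suc i) + 1" "x \<noteq> k \<Longrightarrow> x \<noteq> Suc i \<Longrightarrow> r f x = f x" for f x
    using k by (auto simp: r_def raise_counts_def)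
  have eqs: "q' (x - 1) = (q' x - ?b x) + ?a x \<and> ?c x = ?a x + (?b x - q' x) \<and> ?d x = min (q' x) (?b x)"
    if "x \<in> {1..n}" for x
  proof (cases "x = k \<or> x = Suc i")
    case False
    with other[of x] that r(3) assms(1) show ?thesis by (auto simp: qsol_def)
  next
    case True
    then show ?thesis
    proof
      assume "x = Suc i"
      with q' r(2) at(2-4) show ?thesis
        by (cases "q (Suc i) \<le> b (Suc i)") (auto simp: v_def bc)
    next
      assume "x = k"
      have f1: "v - (if ba then b k - 1 else b k) + (if ba then a k else a k - 1) = (q i - b k) + a k"
        using at(2) assms(5) by (cases "q (Suc i) \<le> b (Suc i)") (auto simp: v bc ba_def)
      have f2: "(if bc then c k else c k - 1) =
          (if ba then a k else a k - 1) + ((if ba then b k - 1 else b k) - v)"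
        unfolding at(6) using at(2) assms(5)
        by (cases "q (Suc i) \<le> b (Suc i)") (auto simp: v bc ba_def)
      have f3: "(if bc then d k - 1 else d k) = min v (if ba then b k - 1 else b k)"
        unfolding at(7) using at(2) assms(5)
        by (cases "q (Suc i) \<le> b (Suc i)") (auto simp: v bc ba_def)
      have raised: "?a k = (if ba then a k else a k - 1)" "?b k = (if ba then b k - 1 else b k)"
        "?c k = (if bc then c k else c k - 1)" "?d k = (if bc then d k - 1 else d k)"
        by (simp_all add: r(1))
      show ?thesis
        unfolding \<open>x = k\<close> raised q'(1,4) at(5) using f1 f2 f3 by simp
    qed
  qed
  obtain x where x: "x \<in> {1..n}" "q x \<le> b x" using assms(1) unfolding qsol_def by auto
  have ex: "\<exists>x\<in>{1..n}. q' x \<le> ?b x"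
  proof (cases "x = k \<or> x = Suc i")
    case False
    with other[of x] x r(3) show ?thesis by (intro bexI[of _ x]) auto
  next
    case True
    \<comment> \<open>If the old emptying box is one of the two changed ones, then one of these two
      empties its queue again, possibly the other one.\<close>
    have "q' k \<le> ?b k \<or> q' (Suc i) \<le> ?b (Suc i)"
    proof (cases "q (Suc i) \<le> b (Suc i)")
      case True
      then show ?thesis using q'(3) r(2)[of b] by simp
    next
      case False
      with True x(2) at(1) have "q i \<le> b k" by auto
      with False at(2) have "a (Suc i) < b k" by linarith
      then have ba by (simp add: ba_def)
      with False \<open>q i \<le> b k\<close> have "v \<le> b k - 1" by (simp add: v bc)
      with \<open>ba\<close> show ?thesis using q'(1) r(1)[of b] by simp
    qed
    with k show ?thesis by blast
  qed
  have "q' 0 = q' n" using assms(1,3,4) k(1)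
    by (auto simp: q'_def closing_letter_def qsol_def)
  with eqs ex e show ?thesis unfolding qsol_def by blast
qed

section \<open>Replacing a letter by its absent successor in a queue\<close>

definition shift_counts :: "nat \<Rightarrow> (nat \<Rightarrow> nat) \<Rightarrow> nat \<Rightarrow> nat" where
  "shift_counts t a = a(t := 0, Suc t := a t)"

text \<open>The queue passes the empty box \<open>Suc t\<close> unchanged. After the shift that box
  does the work of box \<open>t\<close>, so the value \<open>q (t - 1)\<close> is already reached
  between the two.\<close>

lemma qsol_shift:
  assumes "qsol n a b c d q" "1 \<le> t" "t < n" "a (Suc t) = 0" "b (Suc t) = 0"
  shows "\<exists>q'. qsol n (shift_counts t a) (shift_counts t b) (shift_counts t c) (shift_counts t d) q' \<and> q' 0 = q 0"
proof (intro exI conjI)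
  let ?q = "q(t := q (t - 1))"
  have at: "q t = q (Suc t)" "q (t - 1) = (q t - b t) + a t" "c t = a t + (b t - q t)" "d t = min (q t) (b t)"
    using assms(1,2,3,4,5) unfolding qsol_def by (auto dest: bspec[of _ _ t] bspec[of _ _ "Suc t"])
  show "?q 0 = q 0" using assms by auto
  have eqs: "?q (x - 1) = (?q x - shift_counts t b x) + shift_counts t a x \<and>
      shift_counts t c x = shift_counts t a x + (shift_counts t b x - ?q x) \<and>
      shift_counts t d x = min (?q x) (shift_counts t b x)"
    if "x \<in> {1..n}" for x
  proof (cases "x = t \<or> x = Suc t")
    case False
    then have "x - 1 \<noteq> t" using that assms(2) by auto
    with False that assms(1) show ?thesis by (auto simp: qsol_def shift_counts_def)
  next
    case True
    with at assms(2) show ?thesis by (auto simp: shift_counts_def)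
  qed
  obtain x where x: "x \<in> {1..n}" "q x \<le> b x" using assms(1) unfolding qsol_def by auto
  have ex: "\<exists>x\<in>{1..n}. ?q x \<le> shift_counts t b x"
  proof (cases "x = t \<or> x = Suc t")
    case False
    with x show ?thesis by (intro bexI[of _ x]) (auto simp: shift_counts_def)
  next
    case True
    with x at assms show ?thesis
      by (intro bexI[of _ "Suc t"]) (auto simp: shift_counts_def)
  qed
  have "?q 0 = ?q n" using assms by (auto simp: qsol_def)
  with eqs ex show "qsol n (shift_counts t a) (shift_counts t b) (shift_counts t c) (shift_counts t d) ?q"
    unfolding qsol_def by blast
qed

subsection \<open>The combinatorial R-matrix as a queue\<close>

abbreviation cnt :: "nat list \<Rightarrow> nat \<Rightarrow> nat" where
  "cnt w \<equiv> count (mset w)"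

definition is_row :: "nat \<Rightarrow> nat list \<Rightarrow> bool" where
  "is_row n w \<longleftrightarrow> sorted w \<and> set w \<subseteq> {1..n}"

lemma row_words_iff: "w \<in> row_words n k \<longleftrightarrow> length w = k \<and> is_row n w"
  by (auto simp: row_words_def is_row_def)

lemma is_row_eqI:
  assumes "is_row n v" "is_row n w" "\<And>x. x \<in> {1..n} \<Longrightarrow> cnt v x = cnt w x"
  shows "v = w"
proof -
  have "mset v = mset w"
  proof (rule multiset_eqI)
    fix x show "count (mset v) x = count (mset w) x"
    proof (cases "x \<in> {1..n}")
      case False
      then have "x \<notin> set v" "x \<notin> set w" using assms(1,2) by (auto simp: is_row_def)
      then have "cnt v x = 0" "cnt w x = 0" by simp_all
      then show ?thesis by (simp only:)
    qed (rule assms(3))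
  qed
  then show ?thesis using assms(1,2) by (metis is_row_def properties_for_sort)
qed

text \<open>Invariant of the pairing: arcs are conserved at each box, every arc arriving at a box
  with an unpaired dot ends there, and at some box of \<open>B\<close> all arriving arcs end. The
  last clause supplies the emptying box of \<open>qsol\<close> also for words of equal length, where
  no dot stays unpaired.\<close>

definition pairing_flow :: "nat \<Rightarrow> nat list \<Rightarrow> nat list \<Rightarrow> (nat \<Rightarrow> nat) \<Rightarrow> bool" where
  "pairing_flow n a B q \<longleftrightarrow> q 0 = winding_pairs a B \<and> q n = winding_pairs a B \<and>
     (\<forall>x\<in>{1..n}. q (x - 1) + cnt (paired_dots a B) x = q x + cnt a x \<and>
        cnt (paired_dots a B) x \<le> q x \<and>
        (x \<in> set (unpaired_dots a B) \<longrightarrow> q x = cnt (paired_dots a B) x)) \<and>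
     (B \<noteq> [] \<longrightarrow> (\<exists>x\<in>set B. q x = cnt (paired_dots a B) x)) \<and>
     (a = [] \<longrightarrow> (\<forall>x. q x = 0))"

lemma pairing_flowD:
  assumes "pairing_flow n a B q"
  shows "q 0 = winding_pairs a B" "q n = winding_pairs a B"
    "\<And>x. x \<in> {1..n} \<Longrightarrow> q (x - 1) + cnt (paired_dots a B) x = q x + cnt a x"
    "\<And>x. x \<in> {1..n} \<Longrightarrow> cnt (paired_dots a B) x \<le> q x"
    "\<And>x. x \<in> set (unpaired_dots a B) \<Longrightarrow> x \<in> {1..n} \<Longrightarrow> q x = cnt (paired_dots a B) x"
    "B \<noteq> [] \<Longrightarrow> \<exists>x\<in>set B. q x = cnt (paired_dots a B) x"
    "a = [] \<Longrightarrow> q x = 0"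
  using assms unfolding pairing_flow_def by blast+

text \<open>Each pairing adds one unit of flow along its arc. The partner is the cyclically nearest
  available left dot, so the arc meets no other position of \<open>B\<close> and the conditions at
  the remaining dots are undisturbed.\<close>

lemma pairing_flow_exists:
  assumes "set a \<subseteq> {1..n}" "set B \<subseteq> {1..n}" "length a \<le> length B"
  shows "mset (paired_dots a B) + mset (unpaired_dots a B) = mset B \<and> (\<exists>q. pairing_flow n a B q)"
  using assms
proof (induction a arbitrary: B)
  case Nil
  show ?case by (intro conjI exI[of _ "\<lambda>_. 0"]) (auto simp: neq_Nil_conv pairing_flow_def)
next
  case (Cons x a)
  define p B' where "p = partner x B" and "B' = remove1 p B"
  have B: "B \<noteq> []" using Cons.prems by auto
  note part = partner_props[OF B, of x, folded p_def]
  have mB: "mset B = add_mset p (mset B')" using part(1) by (simp add: B'_def)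
  then have setB: "set B = insert p (set B')" by (metis set_mset_add_mset_insert set_mset_mset)
  have lenB: "length B = Suc (length B')" using arg_cong[OF mB, of size] by simp
  have IH: "mset (paired_dots a B') + mset (unpaired_dots a B') = mset B'"
    using Cons.IH[of B'] Cons.prems setB lenB by auto
  obtain q where "pairing_flow n a B' q"
    using Cons.IH[of B'] Cons.prems setB lenB by auto
  note q = pairing_flowD[OF this]
  have x: "x \<in> {1..n}" and p: "p \<in> {1..n}" using Cons.prems part(1) by auto
  \<comment> \<open>\<open>arc y\<close> says that the arc from \<open>x\<close> up to
    \<open>p\<close> crosses from box \<open>y + 1\<close> to box \<open>y\<close>; a winding arc
    leaves through the top and comes back at \<open>n\<close>, hence holds at both 0 and
    \<open>n\<close>.\<close>
  define arc where "arc = (\<lambda>y. if winds x B then y < x \<or> p \<le> y else p \<le> y \<and> y < x)"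
  have px: "winds x B \<Longrightarrow> x \<le> p" "\<not> winds x B \<Longrightarrow> p < x"
    using part(1,2) by (auto simp: winds_def not_less)
  have arc_step: "of_bool (arc (y - 1)) + of_bool (y = p) = (of_bool (arc y) + of_bool (y = x) :: nat)"
    if "y \<in> {1..n}" for y
    using px that by (cases "winds x B") (auto simp: arc_def)
  have arc_p: "arc p" using px by (auto simp: arc_def)
  have arc_B: "arc z \<longleftrightarrow> z = p" if "z \<in> set B" for z
  proof
    show "z = p" if "arc z"
      using that part(3,4)[of z] \<open>z \<in> set B\<close> by (auto simp: arc_def winds_def split: if_splits)
  qed (use arc_p in simp)
  have arc0: "arc 0 = winds x B" "arc n = winds x B"
    using x p px by (auto simp: arc_def)
  let ?q = "\<lambda>y. q y + of_bool (arc y)"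
  have sets: "set (unpaired_dots a B') \<subseteq> set B"
    using arg_cong[OF IH, of set_mset] setB by auto
  have step: "?q (y - 1) + cnt (p # paired_dots a B') y = ?q y + cnt (x # a) y \<and>
      cnt (p # paired_dots a B') y \<le> ?q y \<and>
      (y \<in> set (unpaired_dots a B') \<longrightarrow> ?q y = cnt (p # paired_dots a B') y)" if "y \<in> {1..n}" for y
  proof (intro conjI impI)
    show "?q (y - 1) + cnt (p # paired_dots a B') y = ?q y + cnt (x # a) y"
    proof -
      have "cnt (p # paired_dots a B') y = cnt (paired_dots a B') y + of_bool (y = p)"
        "cnt (x # a) y = cnt a y + of_bool (y = x)" by auto
      then show ?thesis using q(3)[OF that] arc_step[OF that] by linarith
    qed
    show "cnt (p # paired_dots a B') y \<le> ?q y"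
      using q(4)[OF that] arc_p by (cases "y = p") (auto intro: le_SucI)
    show "?q y = cnt (p # paired_dots a B') y" if "y \<in> set (unpaired_dots a B')"
      using q(5)[OF that \<open>y \<in> {1..n}\<close>] arc_B[of y] sets that by auto
  qed
  have ex: "\<exists>z\<in>set B. ?q z = cnt (p # paired_dots a B') z"
  proof (cases "B' = []")
    case True
    then have "a = []" using Cons.prems(3) lenB by simp
    then show ?thesis using q(7) arc_p part(1) by (intro bexI[of _ p]) auto
  next
    case False
    then obtain z where "z \<in> set B'" "q z = cnt (paired_dots a B') z" using q(6) by blast
    then show ?thesis using arc_B[of z] setB by (intro bexI[of _ z]) auto
  qed
  have eqs: "paired_dots (x # a) B = p # paired_dots a B'" "unpaired_dots (x # a) B = unpaired_dots a B'"
    "winding_pairs (x # a) B = of_bool (winds x B) + winding_pairs a B'"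
    by (simp_all add: p_def B'_def)
  show ?case unfolding eqs pairing_flow_def
    using IH mB q(1,2) arc0 step ex by (intro conjI exI[of _ ?q]) auto
qed

lemma R_short_qsol:
  assumes "is_row n a" "is_row n b" "length a \<le> length b" "1 \<le> n" "R_short (a, b) = (c, d)"
  shows "is_row n c" "is_row n d" "length c = length b" "length d = length a"
    "\<exists>q. qsol n (cnt a) (cnt b) (cnt c) (cnt d) q \<and> q 0 = winding_pairs a b"
proof -
  have cd: "c = sort (a @ unpaired_dots a b)" "d = sort (paired_dots a b)"
    using assms(5) by (auto simp: R_short_def)
  have sub: "set a \<subseteq> {1..n}" "set b \<subseteq> {1..n}" using assms(1,2) by (auto simp: is_row_def)
  note pq = pairing_flow_exists[OF sub assms(3)]
  have mb: "mset b = mset (paired_dots a b) + mset (unpaired_dots a b)" using pq by simp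
  have setb: "set b = set (paired_dots a b) \<union> set (unpaired_dots a b)"
    using arg_cong[OF mb, of set_mset] by simp
  have lenb: "length b = length (paired_dots a b) + length (unpaired_dots a b)"
    using arg_cong[OF mb, of size] by simp
  have lenp: "length (paired_dots a B) = length a" for B by (induction a arbitrary: B) auto
  show "is_row n c" "is_row n d" using sub setb by (auto simp: cd is_row_def)
  show "length c = length b" "length d = length a" using lenb lenp by (auto simp: cd)
  obtain q where "pairing_flow n a b q" using pq by blast
  note q = pairing_flowD[OF this]
  have "qsol n (cnt a) (cnt b) (cnt c) (cnt d) q"
    unfolding qsol_def
  proof (intro conjI ballI)
    show "q 0 = q n" using q by simp
    fix x assume x: "x \<in> {1..n}"
    define p u where "p = cnt (paired_dots a b) x" and "u = cnt (unpaired_dots a b) x"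
    have b: "cnt b x = p + u" using mb by (simp add: p_def u_def)
    have h: "q (x - 1) + p = q x + cnt a x" "p \<le> q x" "u = 0 \<or> q x = p"
      using q(3,4,5)[of x] x by (auto simp: p_def u_def count_eq_zero_iff)
    have "cnt c x = cnt a x + u" "cnt d x = p" by (simp_all add: cd p_def u_def)
    with b h show "q (x - 1) = (q x - cnt b x) + cnt a x" "cnt c x = cnt a x + (cnt b x - q x)"
      "cnt d x = min (q x) (cnt b x)" by auto
  next
    show "\<exists>x\<in>{1..n}. q x \<le> cnt b x"
    proof (cases "b = []")
      case True
      then have "a = []" using assms(3) by simp
      then show ?thesis using q(7) assms(4) by (intro bexI[of _ 1]) auto
    next
      case False
      then obtain x where "x \<in> set b" "q x = cnt (paired_dots a b) x" using q(6) by blast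
      then show ?thesis using sub mb by (intro bexI[of _ x]) auto
    qed
  qed
  with q(1) show "\<exists>q. qsol n (cnt a) (cnt b) (cnt c) (cnt d) q \<and> q 0 = winding_pairs a b" by blast
qed

text \<open>Uniqueness of the queue makes any solution a certificate for the value of
  \<open>R_short\<close>, without running the pairing.\<close>

lemma R_short_eqI:
  assumes "is_row n a" "is_row n b" "is_row n c" "is_row n d" "length a \<le> length b" "1 \<le> n"
    and "qsol n (cnt a) (cnt b) (cnt c) (cnt d) q"
  shows "R_short (a, b) = (c, d)" "winding_pairs a b = q 0"
proof -
  obtain c' d' where R: "R_short (a, b) = (c', d')" by fastforce
  note h = R_short_qsol[OF assms(1,2,5,6) R]
  obtain q' where q': "qsol n (cnt a) (cnt b) (cnt c') (cnt d') q'" "q' 0 = winding_pairs a b"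
    using h(5) by blast
  have "c' = c" "d' = d"
    using is_row_eqI[OF h(1) assms(3)] is_row_eqI[OF h(2) assms(4)] qsol_unique(2,3)[OF q'(1) assms(7)]
    by auto
  with R show "R_short (a, b) = (c, d)" by simp
  show "winding_pairs a b = q 0" using qsol_unique(1)[OF q'(1) assms(7), of 0] q'(2) by simp
qed

lemma finite_row_words: "finite (row_words n k)"
  by (rule finite_subset[OF _ finite_lists_length_eq[of "{1..n}" k]]) (auto simp: row_words_def)

text \<open>Injectivity is uniqueness of the reversed queue; surjectivity follows because both
  products are finite of the same size. This makes \<open>inv_into\<close> in
  \<open>R_matrix\<close> a genuine inverse.\<close>

lemma bij_betw_R_short:
  assumes "k \<le> l" "1 \<le> n"
  shows "bij_betw R_short (row_words n k \<times> row_words n l) (row_words n l \<times> row_words n k)"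
proof -
  have into: "R_short ` (row_words n k \<times> row_words n l) \<subseteq> row_words n l \<times> row_words n k"
  proof -
    have "R_short (a, b) \<in> row_words n l \<times> row_words n k" if "a \<in> row_words n k" "b \<in> row_words n l" for a b
    proof -
      obtain c d where cd: "R_short (a, b) = (c, d)" by fastforce
      show ?thesis using R_short_qsol(1-4)[of n a b c d] cd that assms by (simp add: row_words_iff)
    qed
    then show ?thesis by blast
  qed
  have inj: "inj_on R_short (row_words n k \<times> row_words n l)"
  proof -
    have "a = a' \<and> b = b'" if ab: "a \<in> row_words n k" "b \<in> row_words n l" "a' \<in> row_words n k" "b' \<in> row_words n l"
      and eq: "R_short (a, b) = R_short (a', b')" for a b a' b'
    proof -
    obtain c d where cd: "R_short (a, b) = (c, d)" by fastforce
    obtain q where q: "qsol n (cnt a) (cnt b) (cnt c) (cnt d) q"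
      using R_short_qsol(5)[of n a b c d] ab assms cd by (auto simp: row_words_iff)
    obtain q' where q': "qsol n (cnt a') (cnt b') (cnt c) (cnt d) q'"
      using R_short_qsol(5)[of n a' b' c d] ab assms cd eq by (auto simp: row_words_iff)
    show ?thesis
      using qsol_reverse_unique(2,3)[OF q q'] is_row_eqI[of n a a'] is_row_eqI[of n b b'] ab
      by (auto simp: row_words_iff)
    qed
    then show ?thesis by (auto simp: inj_on_def)
  qed
  have "R_short ` (row_words n k \<times> row_words n l) = row_words n l \<times> row_words n k"
    by (rule card_subset_eq[OF _ into])
      (simp_all add: card_image[OF inj] card_cartesian_product finite_row_words)
  with inj show ?thesis by (simp add: bij_betw_def)
qed

text \<open>One relation for both length cases, so that later proofs exhibit a queue instead of
  handling \<open>inv_into\<close>; \<open>w\<close> becomes the winding number.\<close>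

definition R_graph :: "nat \<Rightarrow> nat list \<Rightarrow> nat list \<Rightarrow> nat list \<Rightarrow> nat list \<Rightarrow> nat \<Rightarrow> bool" where
  "R_graph n a b c d w \<longleftrightarrow> length c = length b \<and> length d = length a \<and>
     (\<exists>q. q 0 = w \<and> (if length a \<le> length b then qsol n (cnt a) (cnt b) (cnt c) (cnt d) q
       else qsol n (cnt c) (cnt d) (cnt a) (cnt b) q))"

lemma R_matrix_graph:
  assumes "is_row n a" "is_row n b" "1 \<le> n" "R_matrix n (a, b) = (c, d)"
  shows "is_row n c" "is_row n d" "R_graph n a b c d (winding_count n (a, b))"
proof -
  have "is_row n c \<and> is_row n d \<and> R_graph n a b c d (winding_count n (a, b))"
  proof (cases "length a \<le> length b")
    case True
    then have R: "R_short (a, b) = (c, d)" using assms(4) by (simp add: R_matrix_def)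
    show ?thesis using R_short_qsol[OF assms(1,2) True assms(3) R] True
      by (auto simp: R_graph_def winding_count_def)
  next
    case False
    let ?A = "row_words n (length b) \<times> row_words n (length a)"
    have bij: "bij_betw R_short ?A (row_words n (length a) \<times> row_words n (length b))"
      using bij_betw_R_short[of "length b" "length a" n] False assms by simp
    have ab: "(a, b) \<in> row_words n (length a) \<times> row_words n (length b)"
      using assms by (auto simp: row_words_iff)
    have inv: "(c, d) = inv_into ?A R_short (a, b)" using assms(4) False by (simp add: R_matrix_def)
    have "R_short (c, d) = (a, b)"
      unfolding inv using bij ab by (simp add: bij_betw_def f_inv_into_f)
    moreover have "(c, d) \<in> ?A"
      unfolding inv using bij ab by (metis bij_betw_def inv_into_into)
    ultimately show ?thesis
      using R_short_qsol(5)[of n c d a b] False assms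
      by (auto simp: R_graph_def winding_count_def row_words_iff)
  qed
  then show "is_row n c" "is_row n d" "R_graph n a b c d (winding_count n (a, b))" by auto
qed

lemma R_graph_unique:
  assumes "is_row n a" "is_row n b" "is_row n c" "is_row n d" "1 \<le> n" "R_graph n a b c d w"
  shows "R_matrix n (a, b) = (c, d)" "winding_count n (a, b) = w"
proof -
  have "R_matrix n (a, b) = (c, d) \<and> winding_count n (a, b) = w"
  proof (cases "length a \<le> length b")
    case True
    then show ?thesis using R_short_eqI[of n a b c d] assms
      by (auto simp: R_graph_def R_matrix_def winding_count_def)
  next
    case False
    then obtain q where "qsol n (cnt c) (cnt d) (cnt a) (cnt b) q" "q 0 = w"
      using assms(6) by (auto simp: R_graph_def)
    moreover have len: "length c = length b" "length d = length a" using assms(6) by (auto simp: R_graph_def)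
    ultimately have R: "R_short (c, d) = (a, b)" "winding_pairs c d = w"
      using R_short_eqI[of n c d a b q] assms False by auto
    have "inj_on R_short (row_words n (length b) \<times> row_words n (length a))"
      using bij_betw_R_short[of "length b" "length a" n] False assms by (simp add: bij_betw_def)
    then have "inv_into (row_words n (length b) \<times> row_words n (length a)) R_short (a, b) = (c, d)"
      by (rule inv_into_f_eq) (use R len assms in \<open>auto simp: row_words_iff\<close>)
    with R False show ?thesis by (simp add: R_matrix_def winding_count_def)
  qed
  then show "R_matrix n (a, b) = (c, d)" "winding_count n (a, b) = w" by auto
qed

subsection \<open>Crystal operators on tensors\<close>

definition is_tensor :: "nat \<Rightarrow> row_tensor \<Rightarrow> bool" where
  "is_tensor n H \<longleftrightarrow> (\<forall>h\<in>set H. is_row n h)"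

lemma is_tensor_nth: "is_tensor n H \<Longrightarrow> j < length H \<Longrightarrow> is_row n (H ! j)"
  by (simp add: is_tensor_def)

lemma row_tensors_iff: "H \<in> row_tensors n \<mu> \<longleftrightarrow> is_tensor n H \<and> map length H = \<mu>"
  by (simp add: row_tensors_def row_words_iff is_tensor_def all_set_conv_all_nth list_eq_iff_nth_eq) metis

text \<open>The number of unmatched closing brackets in the factors \<open>H ! (j - 1), \<dots>, H ! 0\<close>, the last ones in
  reading order.\<close>

fun phi :: "nat \<Rightarrow> nat \<Rightarrow> row_tensor \<Rightarrow> nat \<Rightarrow> nat" where
  "phi n i H 0 = 0"
| "phi n i H (Suc j) = cnt (H ! j) (closing_letter n i) + (phi n i H j - cnt (H ! j) (Suc i))"

text \<open>\<open>p\<close> is the factor containing the rightmost unmatched closing bracket: the closing brackets of the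
  factors before it are cancelled by \<open>H ! p\<close>, and the factors after it leave some of those of \<open>H ! p\<close>.\<close>

definition acts :: "nat \<Rightarrow> nat \<Rightarrow> row_tensor \<Rightarrow> nat \<Rightarrow> bool" where
  "acts n i H p \<longleftrightarrow> p < length H \<and> phi n i H p \<le> cnt (H ! p) (Suc i) \<and>
     0 < cnt (H ! p) (closing_letter n i) \<and> (\<forall>j. p < j \<and> j < length H \<longrightarrow> cnt (H ! j) (Suc i) < phi n i H j)"

definition raise_row :: "nat \<Rightarrow> nat \<Rightarrow> nat list \<Rightarrow> nat list" where
  "raise_row n i h = sort (Suc i # remove1 (closing_letter n i) h)"

text \<open>A form of f_i that names the factor acted on and depends only on letter counts;
  \<open>crystal_f_acts\<close> leads back to \<open>crystal_f\<close>.\<close>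

definition step :: "nat \<Rightarrow> nat \<Rightarrow> row_tensor \<Rightarrow> nat \<Rightarrow> row_tensor \<Rightarrow> bool" where
  "step n i H p H' \<longleftrightarrow> acts n i H p \<and> H' = H[p := raise_row n i (H ! p)]"

section \<open>Bracket deletion, factor by factor\<close>

abbreviation closes :: "(bracket \<times> 'p) list \<Rightarrow> (bracket \<times> 'p) list" where
  "closes xs \<equiv> filter (\<lambda>x. fst x = Close) xs"

lemma closes_delete_Close:
  "\<forall>x\<in>set cs. fst x = Close \<Longrightarrow> closes (delete_pairs (cs @ xs)) = cs @ closes (delete_pairs xs)"
  by (induction cs) (auto split: list.split)

text \<open>An opening bracket put in front cancels the first surviving closing bracket, if there is
  one, so a block of them removes a prefix.\<close>

lemma closes_delete_Open:
  "\<forall>x\<in>set os. fst x = Open \<Longrightarrow> closes (delete_pairs (os @ xs)) = drop (length os) (closes (delete_pairs xs))"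
proof (induction os)
  case (Cons x os)
  obtain cs ds where d: "delete_pairs (os @ xs) = cs @ ds" "\<forall>x\<in>set cs. fst x = Close" "\<forall>x\<in>set ds. fst x = Open"
    using delete_pairs_shape by blast
  have "closes (delete_pairs (x # os @ xs)) = tl (closes (delete_pairs (os @ xs)))"
  proof (cases cs)
    case Nil
    with d Cons.prems show ?thesis by (cases ds) (auto simp: filter_empty_conv)
  next
    case (Cons c cs')
    with d \<open>\<forall>x\<in>set (x # os). fst x = Open\<close> show ?thesis by auto
  qed
  then show ?case using Cons by (simp add: drop_Suc tl_drop)
qed simp

lemma closes_then_opens:
  "sorted_wrt (\<lambda>x y. \<not> (fst x = Open \<and> fst y = Close)) xs \<Longrightarrow> xs = closes xs @ filter (\<lambda>x. fst x = Open) xs"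
proof (induction xs)
  case (Cons x xs)
  show ?case
  proof (cases "fst x")
    case Open
    with Cons.prems have "\<forall>y\<in>set xs. fst y \<noteq> Close" by auto
    moreover from this have "\<forall>y\<in>set xs. fst y = Open" by (metis bracket.exhaust)
    ultimately show ?thesis using Open by (auto simp: filter_empty_conv filter_True)
  qed (use Cons in auto)
qed simp

definition factor_signature :: "nat \<Rightarrow> nat \<Rightarrow> row_tensor \<Rightarrow> nat \<Rightarrow> (bracket \<times> nat \<times> nat) list" where
  "factor_signature n i H j =
     map (\<lambda>k. (if H ! j ! k = Suc i then Open else Close, j, k))
       (filter (\<lambda>k. H ! j ! k \<in> {closing_letter n i, Suc i}) ((if i = 0 then rev else id) [0..<length (H ! j)]))"

lemma signature_factors: "signature n i H = concat (map (factor_signature n i H) (rev [0..<length H]))"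
  unfolding signature_def reading_positions_def filter_concat map_concat
  by (simp add: factor_signature_def[abs_def] filter_map o_def comp_def case_prod_unfold)

lemma length_filter_nth: "length (filter (\<lambda>k. xs ! k = x) [0..<length xs]) = cnt xs x"
proof -
  have "filter (\<lambda>y. y = x) xs = filter (\<lambda>y. y = x) (map ((!) xs) [0..<length xs])" by (simp add: map_nth)
  also have "\<dots> = map ((!) xs) (filter (\<lambda>k. xs ! k = x) [0..<length xs])" by (simp add: filter_map o_def)
  finally have "length (filter (\<lambda>k. xs ! k = x) [0..<length xs]) = length (filter (\<lambda>y. y = x) xs)"
    by simp
  also have "\<dots> = cnt xs x" by (induction xs) auto
  finally show ?thesis .
qed

definition factor_split ::
    "nat \<Rightarrow> nat \<Rightarrow> row_tensor \<Rightarrow> nat \<Rightarrow> (bracket \<times> nat \<times> nat) list \<Rightarrow> (bracket \<times> nat \<times> nat) list \<Rightarrow> bool" where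
  "factor_split n i H j cs os \<longleftrightarrow>
    factor_signature n i H j = cs @ os \<and> (\<forall>x\<in>set cs. fst x = Close) \<and> (\<forall>x\<in>set os. fst x = Open) \<and>
    length cs = cnt (H ! j) (closing_letter n i) \<and> length os = cnt (H ! j) (Suc i) \<and>
    (\<forall>x\<in>set cs. \<exists>k. snd x = (j, k) \<and> k < length (H ! j) \<and> H ! j ! k = closing_letter n i)"

text \<open>Rows are sorted, and for \<open>i = 0\<close> they are read backwards; either way the
  closing letters of a factor are read before its opening ones.\<close>

lemma factor_split_exists:
  assumes "is_row n (H ! j)" "2 \<le> n" "i < n"
  shows "\<exists>cs os. factor_split n i H j cs os"
  unfolding factor_split_def
proof (intro exI conjI)
  note k = closing_letter_bounds[OF assms(2,3)]
  let ?h = "H ! j" and ?s = "factor_signature n i H j"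
  have "sorted ?h" using assms by (simp add: is_row_def)
  then have mono: "?h ! k \<le> ?h ! k'" if "k < k'" "k' < length ?h" for k k'
    using that by (simp add: sorted_nth_mono)
  let ?P = "\<lambda>a b. \<not> (?h ! a = Suc i \<and> ?h ! b = closing_letter n i)"
  have "sorted_wrt ?P ((if i = 0 then rev else id) [0..<length ?h])"
  proof (cases "i = 0")
    case True
    have "sorted_wrt (\<lambda>a b. ?P b a) [0..<length ?h]"
      using mono assms(2) True by (auto simp: sorted_wrt_iff_nth_less closing_letter_def) fastforce
    then show ?thesis using True by (simp add: sorted_wrt_rev)
  next
    case False
    have "sorted_wrt ?P [0..<length ?h]"
      using mono False by (auto simp: sorted_wrt_iff_nth_less closing_letter_def) fastforce
    then show ?thesis using False by simp
  qed
  then have "sorted_wrt (\<lambda>x y. \<not> (fst x = Open \<and> fst y = Close)) ?s"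
    unfolding factor_signature_def sorted_wrt_map
    by (intro sorted_wrt_mono_rel[OF _ sorted_wrt_filter]) auto
  then show "?s = closes ?s @ filter (\<lambda>x. fst x = Open) ?s" by (rule closes_then_opens)
  have len: "length (filter (\<lambda>k. ?h ! k = x) ((if i = 0 then rev else id) [0..<length ?h])) = cnt ?h x" for x
    using length_filter_nth[of ?h x] by (simp add: rev_filter[symmetric])
  have "length (closes ?s) = length (filter (\<lambda>k. ?h ! k = closing_letter n i) ((if i = 0 then rev else id) [0..<length ?h]))"
    unfolding factor_signature_def filter_map length_map filter_filter
    by (intro arg_cong[of _ _ length] filter_cong) (use k(3) in auto)
  with len show "length (closes ?s) = cnt ?h (closing_letter n i)" by simp
  have "length (filter (\<lambda>x. fst x = Open) ?s) = length (filter (\<lambda>k. ?h ! k = Suc i) ((if i = 0 then rev else id) [0..<length ?h]))"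
    unfolding factor_signature_def filter_map length_map filter_filter
    by (intro arg_cong[of _ _ length] filter_cong) (use k(3) in auto)
  with len show "length (filter (\<lambda>x. fst x = Open) ?s) = cnt ?h (Suc i)" by simp
  show "\<forall>x\<in>set (closes ?s). \<exists>k. snd x = (j, k) \<and> k < length ?h \<and> ?h ! k = closing_letter n i"
    by (auto simp: factor_signature_def split: if_splits)
qed auto

lemma crystal_f_acts:
  assumes "is_tensor n H" "2 \<le> n" "i < n" "step n i H p H'"
  shows "crystal_f n i H = Some H'"
proof -
  have act: "acts n i H p" and H': "H' = H[p := raise_row n i (H ! p)]" using assms(4) by (auto simp: step_def)
  have p: "p < length H" using act by (simp add: acts_def)
  have "\<forall>j. \<exists>cs os. j < length H \<longrightarrow> factor_split n i H j cs os"
    using factor_split_exists[OF is_tensor_nth[OF assms(1)] assms(2,3)] by blast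
  then obtain cs os where "\<And>j. j < length H \<Longrightarrow> factor_split n i H j (cs j) (os j)"
    by metis
  then have f: "factor_signature n i H j = cs j @ os j" "\<forall>x\<in>set (cs j). fst x = Close"
      "\<forall>x\<in>set (os j). fst x = Open" "length (cs j) = cnt (H ! j) (closing_letter n i)"
      "length (os j) = cnt (H ! j) (Suc i)"
      "\<forall>x\<in>set (cs j). \<exists>k. snd x = (j, k) \<and> k < length (H ! j) \<and> H ! j ! k = closing_letter n i"
    if "j < length H" for j
    using that unfolding factor_split_def by blast+
  \<comment> \<open>\<open>C j\<close> lists the unmatched closing brackets of the last
    \<open>j\<close> factors in reading order; its length is \<open>phi\<close>.\<close>
  define C where "C = (\<lambda>j. closes (delete_pairs (concat (map (factor_signature n i H) (rev [0..<j])))))"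
  have CS: "C (Suc j) = cs j @ drop (length (os j)) (C j)" if "j < length H" for j
    using f(1-3)[OF that] by (simp add: C_def closes_delete_Close closes_delete_Open)
  have len: "length (C j) = phi n i H j" if "j \<le> length H" for j
    using that
  proof (induction j)
    case (Suc j)
    then show ?case using CS[of j] f(4,5)[of j] by simp
  qed (simp add: C_def)
  have last: "C j \<noteq> [] \<and> last (C j) \<in> set (cs p)" if "Suc p \<le> j" "j \<le> length H" for j
    using that
  proof (induction rule: dec_induct)
    case base
    have "C (Suc p) = cs p" using CS[OF p] len[of p] f(5)[OF p] act by (simp add: acts_def)
    moreover have "cs p \<noteq> []" using f(4)[OF p] act by (auto simp: acts_def)
    ultimately show ?case by simp
  next
    case (step j)
    have "length (os j) < length (C j)"
      proof -
      have j: "p < j" "j < length H" using step.hyps step.prems by auto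
      then have "cnt (H ! j) (Suc i) < phi n i H j" using act unfolding acts_def by blast
      then show ?thesis using len[of j] f(5)[OF j(2)] j(2) by simp
    qed
    with CS[of j] step show ?case by simp
  qed
  let ?x = "last (C (length H))"
  have C: "C (length H) \<noteq> []" "?x \<in> set (cs p)" using last[of "length H"] p by auto
  then obtain k where k: "snd ?x = (p, k)" "k < length (H ! p)" "H ! p ! k = closing_letter n i"
    using f(6)[OF p] by blast
  have "crystal_f n i H = Some (change_letter (snd ?x) (Suc i) H)"
    using C(1) by (simp add: crystal_f_def signature_factors C_def Let_def)
  \<comment> \<open>Since the row is sorted again, it does not matter which copy of the letter is
    changed.\<close>
  also have "mset ((H ! p)[k := Suc i]) = mset (Suc i # remove1 (closing_letter n i) (H ! p))"
    unfolding mset_update[OF k(2)] k(3) by simp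
  then have "sort ((H ! p)[k := Suc i]) = raise_row n i (H ! p)"
    unfolding raise_row_def by (metis mset_sort properties_for_sort sorted_sort)
  then have "change_letter (snd ?x) (Suc i) H = H'" by (simp add: k(1) change_letter_def H')
  finally show ?thesis .
qed

lemma mset_raise_row:
  "mset (raise_row n i h) = add_mset (Suc i) (mset h - {#closing_letter n i#})"
  by (simp add: raise_row_def)

lemma is_row_raise_row:
  assumes "is_row n h" "i < n"
  shows "is_row n (raise_row n i h)"
  using assms set_remove1_subset[of "closing_letter n i" h]
  unfolding is_row_def raise_row_def set_sort by (auto simp del: sort_key_simps)

lemma cnt_raise_row:
  assumes "2 \<le> n" "i < n" "0 < cnt h (closing_letter n i)"
  shows "cnt (raise_row n i h) = raise_counts (closing_letter n i) (Suc i) (cnt h)"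
  using closing_letter_bounds[OF assms(1,2)] assms(3)
  by (auto simp: mset_raise_row raise_counts_def fun_eq_iff)

lemma length_raise_row:
  assumes "0 < cnt h (closing_letter n i)"
  shows "length (raise_row n i h) = length h"
proof -
  have "closing_letter n i \<in> set h" using assms by simp
  then show ?thesis
    using length_pos_if_in_set[of "closing_letter n i" h]
    unfolding raise_row_def length_sort by (simp add: length_remove1)
qed

lemma step_tensor:
  assumes "step n i H p H'" "is_tensor n H" "i < n"
  shows "is_tensor n H'" "map length H' = map length H" "length H' = length H" "p < length H"
proof -
  have p: "p < length H" "0 < cnt (H ! p) (closing_letter n i)" "H' = H[p := raise_row n i (H ! p)]"
    using assms(1) by (auto simp: step_def acts_def)
  show "is_tensor n H'"
    using is_row_raise_row[OF is_tensor_nth[OF assms(2) p(1)] assms(3)] assms(2) set_update_subset_insert[of H p]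
    unfolding p(3) is_tensor_def by blast
  show "map length H' = map length H"
    using p(1) by (simp add: p(3) map_update length_raise_row[OF p(2)] list_update_same_conv)
  show "length H' = length H" "p < length H" using p by auto
qed

section \<open>Unmatched brackets along arrows\<close>

lemma phi_cong:
  assumes "\<And>j. j < m \<Longrightarrow> cnt (H ! j) (closing_letter n i) = cnt (H' ! j) (closing_letter n i) \<and>
    cnt (H ! j) (Suc i) = cnt (H' ! j) (Suc i)"
  shows "phi n i H m = phi n i H' m"
  using assms by (induction m) auto

lemma acts_exists:
  assumes "0 < phi n i H (length H)"
  shows "\<exists>p. acts n i H p"
proof -
  have "\<exists>p. p < m \<and> phi n i H p \<le> cnt (H ! p) (Suc i) \<and> 0 < cnt (H ! p) (closing_letter n i) \<and>
      (\<forall>j. p < j \<and> j < m \<longrightarrow> cnt (H ! j) (Suc i) < phi n i H j)" if "0 < phi n i H m" for m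
    using that
  proof (induction m)
    case (Suc m)
    show ?case
    proof (cases "phi n i H m \<le> cnt (H ! m) (Suc i)")
      case True
      with Suc.prems show ?thesis by (intro exI[of _ m]) auto
    next
      case False
      then obtain p where "p < m" "phi n i H p \<le> cnt (H ! p) (Suc i)" "0 < cnt (H ! p) (closing_letter n i)"
          "\<forall>j. p < j \<and> j < m \<longrightarrow> cnt (H ! j) (Suc i) < phi n i H j"
        using Suc.IH by auto
      with False show ?thesis by (intro exI[of _ p]) (auto simp: less_Suc_eq)
    qed
  qed simp
  from this[OF assms] show ?thesis by (auto simp: acts_def)
qed

text \<open>By \<open>acts\<close> no truncated subtraction after \<open>p\<close> reaches 0, so the
  closing bracket lost at \<open>p\<close> is missing at every later place.\<close>

lemma phi_step:
  assumes "step n i H p H'" "2 \<le> n" "i < n" "p < j" "j \<le> length H"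
  shows "phi n i H j = Suc (phi n i H' j)"
proof -
  have act: "acts n i H p" and H': "H' = H[p := raise_row n i (H ! p)]" using assms(1) by (auto simp: step_def)
  note k = closing_letter_bounds[OF assms(2,3)]
  from assms(4) have "Suc p \<le> j" by simp
  then show ?thesis
    using assms(5)
  proof (induction j rule: dec_induct)
    case base
    have "phi n i H' p = phi n i H p" by (rule phi_cong) (simp add: H')
    moreover have "H' ! p = raise_row n i (H ! p)" using base by (simp add: H')
    ultimately show ?case using act k cnt_raise_row[OF assms(2,3), of "H ! p"]
      by (auto simp: acts_def raise_counts_def)
  next
    case (step m)
    then have "phi n i H m = Suc (phi n i H' m)" by simp
    moreover have "p < m" "m < length H" using step.hyps step.prems by auto
    then have "cnt (H ! m) (Suc i) < phi n i H m" "H' ! m = H ! m"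
      using act unfolding acts_def H' by auto
    ultimately show ?case by simp
  qed
qed

text \<open>All opening brackets are matched by factors read later, that is, e_i gives 0.\<close>

definition highest :: "nat \<Rightarrow> nat \<Rightarrow> row_tensor \<Rightarrow> bool" where
  "highest n i H \<longleftrightarrow> (\<forall>j<length H. cnt (H ! j) (Suc i) \<le> phi n i H j)"

text \<open>This is e_i, expressed as an incoming f_i arrow. The falling sum of letters makes the
  ascent to a highest weight element terminate.\<close>

lemma step_into:
  assumes "is_tensor n H" "2 \<le> n" "1 \<le> i" "i < n" "\<not> highest n i H"
  shows "\<exists>p H'. step n i H' p H \<and> is_tensor n H' \<and> map length H' = map length H \<and>
    sum_list (map sum_list H') < sum_list (map sum_list H)"
proof -
  let ?P = "\<lambda>j. j < length H \<and> phi n i H j < cnt (H ! j) (Suc i)"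
  have cl: "closing_letter n i = i" using assms by (simp add: closing_letter_def)
  \<comment> \<open>Factors are read from the end of the list, so the leftmost unmatched opening
    bracket lies in the factor of greatest index that has one.\<close>
  define p where "p = (GREATEST j. ?P j)"
  obtain j where j: "?P j" using assms(5) by (auto simp: highest_def not_le)
  have bound: "\<And>j. ?P j \<Longrightarrow> j \<le> length H" by simp
  have p: "?P p" unfolding p_def by (rule GreatestI_nat[of ?P, OF j bound])
  have max: "j \<le> p" if "?P j" for j
    unfolding p_def by (rule Greatest_le_nat[of ?P, OF that bound])
  define h H' where "h = sort (i # remove1 (Suc i) (H ! p))" and "H' = H[p := h]"
  have mem: "Suc i \<in> set (H ! p)" using p by (metis count_mset_0_iff less_nat_zero_code)
  have mh: "mset h = add_mset i (mset (H ! p) - {#Suc i#})" by (simp add: h_def)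
  have rows: "is_row n (H ! p)" using is_tensor_nth[OF assms(1)] p by simp
  have hrow: "is_row n h"
    using rows assms set_remove1_subset[of "Suc i" "H ! p"]
    unfolding is_row_def h_def set_sort by (auto simp del: sort_key_simps)
  have len: "length h = length (H ! p)"
    using mem length_pos_if_in_set[OF mem] unfolding h_def length_sort by (simp add: length_remove1)
  have "raise_row n i h = H ! p"
  proof -
    have "mset (raise_row n i h) = mset (H ! p)"
      unfolding mset_raise_row cl mh using mem by simp
    then show ?thesis using rows by (metis is_row_def properties_for_sort raise_row_def mset_sort)
  qed
  moreover have nth: "H' ! p = h" "\<And>j. j \<noteq> p \<Longrightarrow> H' ! j = H ! j" "length H' = length H"
    using p by (auto simp: H'_def)
  ultimately have H: "H = H'[p := raise_row n i (H' ! p)]" by (simp add: H'_def)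
  have cnth: "cnt h i = Suc (cnt (H ! p) i)" "Suc (cnt h (Suc i)) = cnt (H ! p) (Suc i)"
    using mem by (auto simp: mh)
  have phip: "phi n i H' p = phi n i H p" by (rule phi_cong) (simp add: nth)
  have phi: "phi n i H' j = Suc (phi n i H j)" if "Suc p \<le> j" "j \<le> length H" for j
    using that
  proof (induction rule: dec_induct)
    case base
    show ?case using phip p cnth by (simp add: nth cl)
  next
    case (step j)
    moreover have "cnt (H ! j) (Suc i) \<le> phi n i H j" using max[of j] step by force
    ultimately show ?case by (simp add: nth(2))
  qed
  have "acts n i H' p"
    unfolding acts_def
  proof (intro conjI allI impI)
    fix j assume j: "p < j \<and> j < length H'"
    then have "cnt (H ! j) (Suc i) \<le> phi n i H j" using max[of j] nth by force
    with phi[of j] j show "cnt (H' ! j) (Suc i) < phi n i H' j" by (simp add: nth)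
  qed (use p nth cnth phip cl in auto)
  then have "step n i H' p H" using H by (simp add: step_def)
  moreover have "is_tensor n H'"
    using assms(1) hrow set_update_subset_insert[of H p h] unfolding H'_def is_tensor_def by blast
  moreover have "map length H' = map length H" using p by (simp add: H'_def map_update len list_update_same_conv)
  moreover have "sum_list (map sum_list H') < sum_list (map sum_list H)"
  proof -
    have "sum_list (H ! p) = Suc (sum_list h)"
    proof -
      have "mset (H ! p) = add_mset (Suc i) (mset (H ! p) - {#Suc i#})" using mem by simp
      then have "sum_mset (mset (H ! p)) = Suc (sum_mset (mset h))" unfolding mh
        by (metis add_Suc sum_mset.add_mset)
      then show ?thesis by (simp add: sum_mset_sum_list)
    qed
    moreover have "sum_list (map sum_list H') + sum_list (H ! p) = sum_list (map sum_list H) + sum_list h"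
      using p member_le_sum_list[of "sum_list (H ! p)" "map sum_list H"]
      by (simp add: H'_def map_update sum_list_update)
    ultimately show ?thesis by simp
  qed
  ultimately show ?thesis by blast
qed

subsection \<open>Energy along crystal arrows\<close>

lemma sigma_nth:
  assumes "R_matrix n (H ! Suc k, H ! k) = (c, d)" "Suc k < length H"
  shows "sigma n k H ! Suc k = c" "sigma n k H ! k = d"
    "j \<noteq> k \<Longrightarrow> j \<noteq> Suc k \<Longrightarrow> sigma n k H ! j = H ! j"
  using assms by (auto simp: sigma_def)

lemma length_sigma [simp]: "length (sigma n k H) = length H"
  by (simp add: sigma_def split: prod.split)

lemma is_tensor_sigma:
  assumes "is_tensor n H" "1 \<le> n" "Suc k < length H"
  shows "is_tensor n (sigma n k H)"
proof -
  obtain c d where R: "R_matrix n (H ! Suc k, H ! k) = (c, d)" by fastforce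
  have "is_row n c" "is_row n d"
    using R_matrix_graph(1,2)[OF _ _ assms(2) R] is_tensor_nth[OF assms(1)] assms(3) by auto
  then have "is_row n (sigma n k H ! j)" if "j < length H" for j
    using sigma_nth[OF R assms(3)] is_tensor_nth[OF assms(1) that] by (cases "j = k"; cases "j = Suc k") auto
  then show ?thesis by (auto simp: is_tensor_def in_set_conv_nth)
qed

lemma sigma_graph:
  assumes "is_tensor n H" "1 \<le> n" "Suc k < length H"
  shows "R_graph n (H ! Suc k) (H ! k) (sigma n k H ! Suc k) (sigma n k H ! k) (local_energy n k H)"
proof -
  obtain c d where R: "R_matrix n (H ! Suc k, H ! k) = (c, d)" by fastforce
  show ?thesis
    using R_matrix_graph(3)[OF _ _ assms(2) R] is_tensor_nth[OF assms(1)] assms(3)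
    by (simp add: sigma_nth[OF R assms(3)] local_energy_def)
qed

lemma sigma_unique:
  assumes "is_tensor n H" "is_row n c" "is_row n d" "1 \<le> n" "Suc k < length H"
    and "R_graph n (H ! Suc k) (H ! k) c d w"
  shows "sigma n k H = H[Suc k := c, k := d]" "local_energy n k H = w"
  using R_graph_unique[OF _ _ assms(2,3,4,6)] is_tensor_nth[OF assms(1)] assms(5)
  by (auto simp: sigma_def local_energy_def)

lemma sigma_content:
  assumes "is_tensor n H" "1 \<le> n" "Suc k < length H" "x \<in> {1..n}"
  shows "cnt (sigma n k H ! Suc k) x + cnt (sigma n k H ! k) x = cnt (H ! Suc k) x + cnt (H ! k) x"
proof -
  obtain q where "qsol n (cnt (H ! Suc k)) (cnt (H ! k)) (cnt (sigma n k H ! Suc k)) (cnt (sigma n k H ! k)) q \<or>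
      qsol n (cnt (sigma n k H ! Suc k)) (cnt (sigma n k H ! k)) (cnt (H ! Suc k)) (cnt (H ! k)) q"
    using sigma_graph[OF assms(1-3)] unfolding R_graph_def by (auto split: if_splits)
  then show ?thesis by (elim disjE) (simp_all only: qsol_content[OF _ assms(4)])
qed

lemma sigma_signature:
  assumes "is_tensor n H" "2 \<le> n" "Suc k < length H" "i < n"
  defines "m \<equiv> closing_letter n i" and "G \<equiv> sigma n k H"
  shows "cnt (G ! Suc k) m + (cnt (G ! k) m - cnt (G ! Suc k) (Suc i)) =
      cnt (H ! Suc k) m + (cnt (H ! k) m - cnt (H ! Suc k) (Suc i))"
    "cnt (G ! k) (Suc i) + (cnt (G ! Suc k) (Suc i) - cnt (G ! k) m) =
      cnt (H ! k) (Suc i) + (cnt (H ! Suc k) (Suc i) - cnt (H ! k) m)"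
proof -
  obtain q where "qsol n (cnt (H ! Suc k)) (cnt (H ! k)) (cnt (G ! Suc k)) (cnt (G ! k)) q \<or>
      qsol n (cnt (G ! Suc k)) (cnt (G ! k)) (cnt (H ! Suc k)) (cnt (H ! k)) q"
    using sigma_graph[OF assms(1) _ assms(3)] assms(2) unfolding R_graph_def G_def
    by (auto split: if_splits)
  then show "cnt (G ! Suc k) m + (cnt (G ! k) m - cnt (G ! Suc k) (Suc i)) =
      cnt (H ! Suc k) m + (cnt (H ! k) m - cnt (H ! Suc k) (Suc i))"
    "cnt (G ! k) (Suc i) + (cnt (G ! Suc k) (Suc i) - cnt (G ! k) m) =
      cnt (H ! k) (Suc i) + (cnt (H ! Suc k) (Suc i) - cnt (H ! k) m)"
    using qsol_signature[OF _ assms(2,4) m_def[THEN meta_eq_to_obj_eq]] by metis+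
qed

text \<open>Two adjacent factors act on the \<open>t\<close> unmatched closing brackets to their
  right like a single factor carrying the unmatched brackets of the pair.\<close>

lemma pair_signature:
  fixes A B C D t :: nat
  shows "A + ((B + (t - C)) - D) = (A + (B - D)) + (t - (C + (D - B)))"
  by (cases "B \<le> D") auto

text \<open>Separate conditions on two factors merge into one on the unmatched opening brackets of
  the pair, which \<open>sigma_signature\<close> preserves. This carries \<open>highest\<close> and
  \<open>acts\<close> across \<open>sigma\<close>.\<close>

lemma pair_opens:
  fixes B C D t :: nat
  shows "C < t \<and> D < B + (t - C) \<longleftrightarrow> C + (D - B) < t" "C \<le> t \<and> D \<le> B + (t - C) \<longleftrightarrow> C + (D - B) \<le> t"
  by (cases "B \<le> D"; auto)+

text \<open>Place \<open>Suc k\<close> is excluded because it separates the two exchanged factors;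
  beyond both of them only the signature of the pair matters.\<close>

lemma phi_sigma:
  assumes "is_tensor n H" "2 \<le> n" "Suc k < length H" "i < n" "j \<noteq> Suc k"
  shows "phi n i (sigma n k H) j = phi n i H j"
proof -
  obtain c d where R: "R_matrix n (H ! Suc k, H ! k) = (c, d)" by fastforce
  note nth = sigma_nth[OF R assms(3)]
  have low: "phi n i (sigma n k H) j = phi n i H j" if "j \<le> k" for j
    by (rule phi_cong) (use that nth(3) in auto)
  have high: "phi n i (sigma n k H) j = phi n i H j" if "Suc (Suc k) \<le> j" for j
    using that
  proof (induction j rule: dec_induct)
    case base
    show ?case
      using sigma_signature[OF assms(1-4)] low[of k] by (simp add: pair_signature)
  next
    case (step m)
    then show ?case using nth(3)[of m] by simp
  qed
  show ?thesis using low[of j] high[of j] assms(5) by linarith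
qed

lemma highest_sigma:
  assumes "is_tensor n H" "2 \<le> n" "Suc k < length H" "i < n" "highest n i H"
  shows "highest n i (sigma n k H)"
  unfolding highest_def
proof (intro allI impI)
  fix j assume j: "j < length (sigma n k H)"
  obtain c d where R: "R_matrix n (H ! Suc k, H ! k) = (c, d)" by fastforce
  note nth = sigma_nth[OF R assms(3)]
  show "cnt (sigma n k H ! j) (Suc i) \<le> phi n i (sigma n k H) j"
  proof (cases "j = k \<or> j = Suc k")
    case False
    with nth(3)[of j] assms(5) j phi_sigma[OF assms(1-4), of j] show ?thesis
      by (simp add: highest_def)
  next
    case True
    let ?t = "phi n i H k" and ?m = "closing_letter n i"
    have t: "phi n i (sigma n k H) k = ?t" using phi_sigma[OF assms(1-4), of k] by simp
    have "cnt (H ! k) (Suc i) \<le> ?t" "cnt (H ! Suc k) (Suc i) \<le> phi n i H (Suc k)"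
      using assms(3,5) Suc_lessD[OF assms(3)] unfolding highest_def by blast+
    then have "cnt (H ! k) (Suc i) + (cnt (H ! Suc k) (Suc i) - cnt (H ! k) ?m) \<le> ?t"
      using pair_opens(2) by simp
    then have "cnt (sigma n k H ! k) (Suc i) \<le> ?t \<and>
        cnt (sigma n k H ! Suc k) (Suc i) \<le> cnt (sigma n k H ! k) ?m + (?t - cnt (sigma n k H ! k) (Suc i))"
      unfolding pair_opens(2) sigma_signature(2)[OF assms(1-4)] .
    with True t show ?thesis by auto
  qed
qed

lemma step_sigma_outside:
  assumes "is_tensor n H" "2 \<le> n" "Suc k < length H" "i < n" "step n i H p H'" "p \<noteq> k" "p \<noteq> Suc k"
  shows "step n i (sigma n k H) p (sigma n k H')" "local_energy n k H' = local_energy n k H"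
proof -
  obtain c d where R: "R_matrix n (H ! Suc k, H ! k) = (c, d)" by fastforce
  note nth = sigma_nth[OF R assms(3)]
  have act: "acts n i H p" and H': "H' = H[p := raise_row n i (H ! p)]" using assms(5) by (auto simp: step_def)
  have same: "H' ! k = H ! k" "H' ! Suc k = H ! Suc k" using assms(6,7) by (auto simp: H')
  then show "local_energy n k H' = local_energy n k H" by (simp add: local_energy_def)
  have "sigma n k H' = H[p := raise_row n i (H ! p), Suc k := c, k := d]"
    using R same by (simp add: sigma_def H')
  also have "\<dots> = (sigma n k H)[p := raise_row n i (H ! p)]"
    using R assms(6,7) by (simp add: sigma_def list_update_swap)
  finally have 1: "sigma n k H' = (sigma n k H)[p := raise_row n i (sigma n k H ! p)]"
    using nth(3) assms(6,7) by simp
  have "acts n i (sigma n k H) p"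
    unfolding acts_def
  proof (intro conjI allI impI)
    show "p < length (sigma n k H)" "phi n i (sigma n k H) p \<le> cnt (sigma n k H ! p) (Suc i)"
      "0 < cnt (sigma n k H ! p) (closing_letter n i)"
      using act nth(3) assms(6,7) phi_sigma[OF assms(1-4), of p] by (auto simp: acts_def)
    fix j assume j: "p < j \<and> j < length (sigma n k H)"
    show "cnt (sigma n k H ! j) (Suc i) < phi n i (sigma n k H) j"
    proof (cases "j = k \<or> j = Suc k")
      case False
      with nth(3)[of j] act j phi_sigma[OF assms(1-4), of j] show ?thesis by (simp add: acts_def)
    next
      case True
      let ?t = "phi n i H k" and ?m = "closing_letter n i"
      have t: "phi n i (sigma n k H) k = ?t" using phi_sigma[OF assms(1-4), of k] by simp
      have "p < k" using True j assms(6) by auto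
      then have "p < k \<and> k < length H" "p < Suc k \<and> Suc k < length H" using assms(3) by auto
      then have "cnt (H ! k) (Suc i) < ?t" "cnt (H ! Suc k) (Suc i) < phi n i H (Suc k)"
        using act unfolding acts_def by blast+
      then have "cnt (H ! k) (Suc i) + (cnt (H ! Suc k) (Suc i) - cnt (H ! k) ?m) < ?t"
        using pair_opens(1) by simp
      then have "cnt (sigma n k H ! k) (Suc i) < ?t \<and>
          cnt (sigma n k H ! Suc k) (Suc i) < cnt (sigma n k H ! k) ?m + (?t - cnt (sigma n k H ! k) (Suc i))"
        unfolding pair_opens(1) sigma_signature(2)[OF assms(1-4)] .
      with True t show ?thesis by auto
    qed
  qed
  with 1 show "step n i (sigma n k H) p (sigma n k H')" by (simp add: step_def)
qed

text \<open>For a longer left word the queue runs from \<open>(c, d)\<close> to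
  \<open>(a, b)\<close>, which exchanges \<open>ba\<close> and \<open>bc\<close>; the change of the
  winding number is symmetric under this exchange.\<close>

lemma R_graph_raise:
  assumes "R_graph n a b c d w" "2 \<le> n" "i < n" "m = closing_letter n i"
    and "0 < cnt a m + (cnt b m - cnt a (Suc i))"
    and "0 < cnt c m + (cnt d m - cnt c (Suc i))"
  defines "ba \<equiv> cnt a (Suc i) < cnt b m" and "bc \<equiv> cnt c (Suc i) < cnt d m"
  defines "r \<equiv> raise_row n i"
  shows "\<exists>w'. R_graph n (if ba then a else r a) (if ba then r b else b)
      (if bc then c else r c) (if bc then r d else d) w' \<and>
    int w' = int w + of_bool (i = 0) * (of_bool (\<not> ba) - of_bool bc)"
proof -
  let ?a = "if ba then a else r a" and ?b = "if ba then r b else b"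
    and ?c = "if bc then c else r c" and ?d = "if bc then r d else d"
  let ?f = "raise_counts m (Suc i)"
  have pos: "ba \<Longrightarrow> 0 < cnt b m" "\<not> ba \<Longrightarrow> 0 < cnt a m" "bc \<Longrightarrow> 0 < cnt d m" "\<not> bc \<Longrightarrow> 0 < cnt c m"
    using assms(5,6) unfolding ba_def bc_def by linarith+
  have cnt: "cnt ?a = (if ba then cnt a else ?f (cnt a))" "cnt ?b = (if ba then ?f (cnt b) else cnt b)"
    "cnt ?c = (if bc then cnt c else ?f (cnt c))" "cnt ?d = (if bc then ?f (cnt d) else cnt d)"
    using cnt_raise_row[OF assms(2,3)] pos unfolding r_def assms(4) by (simp_all only: split: if_split) auto
  have len: "length ?a = length a" "length ?b = length b" "length ?c = length c" "length ?d = length d"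
    using length_raise_row[of _ n i] pos unfolding r_def assms(4) by (simp_all only: split: if_split) auto
  have lengths: "length c = length b" "length d = length a"
    using assms(1) by (simp_all add: R_graph_def)
  show ?thesis
  proof (cases "length a \<le> length b")
    case True
    then obtain q where q: "qsol n (cnt a) (cnt b) (cnt c) (cnt d) q" "q 0 = w"
      using assms(1) by (auto simp: R_graph_def)
    from qsol_raise[OF q(1) assms(2,3,4,5), folded ba_def bc_def cnt, unfolded q(2)]
    obtain q' where "qsol n (cnt ?a) (cnt ?b) (cnt ?c) (cnt ?d) q'"
      "int (q' 0) = int w + of_bool (i = 0) * (of_bool (\<not> ba) - of_bool bc)"
      by (elim exE conjE)
    moreover from this(1) have "R_graph n ?a ?b ?c ?d (q' 0)"
      unfolding R_graph_def len if_P[OF True] using lengths by (intro conjI exI[of _ q'] refl)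
    ultimately show ?thesis by (intro exI[of _ "q' 0"] conjI)
  next
    case False
    then obtain q where q: "qsol n (cnt c) (cnt d) (cnt a) (cnt b) q" "q 0 = w"
      using assms(1) by (auto simp: R_graph_def)
    from qsol_raise[OF q(1) assms(2,3,4,6), folded ba_def bc_def cnt, unfolded q(2)]
    obtain q' where q': "qsol n (cnt ?c) (cnt ?d) (cnt ?a) (cnt ?b) q'"
      "int (q' 0) = int w + of_bool (i = 0) * (of_bool (\<not> bc) - of_bool ba)"
      by (elim exE conjE)
    have "(of_bool (\<not> bc) - of_bool ba :: int) = of_bool (\<not> ba) - of_bool bc" by auto
    moreover from q'(1) have "R_graph n ?a ?b ?c ?d (q' 0)"
      unfolding R_graph_def len if_not_P[OF False] using lengths by (intro conjI exI[of _ q'] refl)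
    ultimately show ?thesis using q'(2) by (intro exI[of _ "q' 0"] conjI) simp_all
  qed
qed

text \<open>That f_i acts somewhere in the pair is a condition on the signature of the pair, hence
  still true after R; \<open>ba\<close> and \<open>bc\<close> then tell which of the two factors is
  hit.\<close>

lemma step_sigma_inside:
  assumes "is_tensor n H" "2 \<le> n" "Suc k < length H" "i < n" "step n i H p H'" "p = k \<or> p = Suc k"
  shows "\<exists>p'. step n i (sigma n k H) p' (sigma n k H') \<and>
    int (local_energy n k H') = int (local_energy n k H) + of_bool (i = 0) * (of_bool (p = Suc k) - of_bool (p' = k))"
proof -
  have act: "acts n i H p" and H': "H' = H[p := raise_row n i (H ! p)]" using assms(5) by (auto simp: step_def)
  let ?G = "sigma n k H"
  define m a b c d where "m = closing_letter n i" and "a = H ! Suc k" and "b = H ! k"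
    and "c = ?G ! Suc k" and "d = ?G ! k"
  define t where "t = phi n i H k"
  have tG: "phi n i ?G k = t" using phi_sigma[OF assms(1-4), of k] by (simp add: t_def)
  note sg = sigma_signature[OF assms(1-4), folded m_def a_def b_def c_def d_def]
  define ba bc where "ba \<longleftrightarrow> cnt a (Suc i) < cnt b m" and "bc \<longleftrightarrow> cnt c (Suc i) < cnt d m"
  have "(p = k \<longleftrightarrow> ba) \<and> 0 < cnt a m + (cnt b m - cnt a (Suc i)) \<and>
      t \<le> cnt b (Suc i) + (cnt a (Suc i) - cnt b m)"
  proof (cases "p = k")
    case True
    with act assms(3) have "t \<le> cnt b (Suc i)" "cnt a (Suc i) < cnt b m + (t - cnt b (Suc i))"
      by (auto simp: acts_def t_def a_def b_def m_def)
    with True show ?thesis by (auto simp: ba_def)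
  next
    case False
    with act assms(6) have "cnt b m + (t - cnt b (Suc i)) \<le> cnt a (Suc i)" "0 < cnt a m"
      by (auto simp: acts_def t_def a_def b_def m_def)
    with False show ?thesis by (auto simp: ba_def)
  qed
  then have p: "p = k \<longleftrightarrow> ba" and pos: "0 < cnt a m + (cnt b m - cnt a (Suc i))"
    and t: "t \<le> cnt b (Suc i) + (cnt a (Suc i) - cnt b m)" by auto
  define p' where "p' = (if bc then k else Suc k)"
  have pos': "0 < cnt c m + (cnt d m - cnt c (Suc i))" using pos sg by simp
  have t': "t \<le> cnt d (Suc i) + (cnt c (Suc i) - cnt d m)" using t sg by simp
  have beyond: "cnt (?G ! j) (Suc i) < phi n i ?G j" if "Suc k < j" "j < length H" for j
  proof -
    obtain x y where R: "R_matrix n (H ! Suc k, H ! k) = (x, y)" by fastforce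
    show ?thesis
      using sigma_nth(3)[OF R assms(3), of j] phi_sigma[OF assms(1-4), of j] that act assms(6)
      by (auto simp: acts_def)
  qed
  have act': "acts n i ?G p'"
  proof (cases bc)
    case True
    then have "t \<le> cnt d (Suc i)" "cnt c (Suc i) < cnt d m" "0 < cnt d m"
      using t' unfolding bc_def by linarith+
    moreover from this tG have "cnt (?G ! Suc k) (Suc i) < phi n i ?G (Suc k)"
      by (simp add: c_def d_def m_def)
    with beyond have "cnt (?G ! j) (Suc i) < phi n i ?G j" if "k < j" "j < length H" for j
      using that by (cases "j = Suc k") auto
    ultimately show ?thesis
      using True assms(3) tG unfolding acts_def p'_def by (simp add: c_def d_def m_def)
  next
    case False
    then have "cnt d m + (t - cnt d (Suc i)) \<le> cnt c (Suc i)" "0 < cnt c m"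
      using t' pos' by (auto simp: bc_def)
    then show ?thesis
      using False assms(3) beyond tG
      unfolding acts_def p'_def
      by (simp add: c_def d_def m_def)
  qed
  have tG': "is_tensor n ?G" using is_tensor_sigma[OF assms(1) _ assms(3)] assms(2) by simp
  have tH': "is_tensor n H'" using step_tensor(1)[OF assms(5,1,4)] .
  define r where "r = raise_row n i"
  let ?a = "if ba then a else r a" and ?b = "if ba then r b else b"
    and ?c = "if bc then c else r c" and ?d = "if bc then r d else d"
  have nth: "H' ! Suc k = ?a" "H' ! k = ?b"
    using p assms(3,6) by (auto simp: H' a_def b_def r_def)
  have rows: "is_row n ?c" "is_row n ?d"
    using is_tensor_nth[OF tG'] assms(3) is_row_raise_row[OF _ assms(4)] by (auto simp: c_def d_def r_def)
  have "R_graph n a b c d (local_energy n k H)"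
    using sigma_graph[OF assms(1) _ assms(3)] assms(2) by (simp add: a_def b_def c_def d_def)
  from R_graph_raise[OF this assms(2,4) m_def pos pos', folded ba_def bc_def r_def]
  obtain w' where w': "R_graph n (H' ! Suc k) (H' ! k) ?c ?d w'"
    "int w' = int (local_energy n k H) + of_bool (i = 0) * (of_bool (\<not> ba) - of_bool bc)"
    unfolding nth by blast
  have len: "Suc k < length H'" using assms(3) by (simp add: H')
  have "1 \<le> n" using assms(2) by simp
  note u = sigma_unique[OF tH' rows this len w'(1)]
  have cd: "?G = H[Suc k := c, k := d]"
    unfolding c_def d_def by (auto simp: sigma_def split: prod.split) (use assms(3) in simp)
  have "sigma n k H' = ?G[p' := raise_row n i (?G ! p')]"
  proof (rule nth_equalityI)
    fix j assume j: "j < length (sigma n k H')"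
    obtain x y where R: "R_matrix n (H ! Suc k, H ! k) = (x, y)" by fastforce
    have Gj: "j \<noteq> k \<Longrightarrow> j \<noteq> Suc k \<Longrightarrow> ?G ! j = H ! j" using sigma_nth(3)[OF R assms(3)] .
    show "sigma n k H' ! j = ?G[p' := raise_row n i (?G ! p')] ! j"
      using j len Gj assms(6) unfolding u(1)
      by (cases "j = k"; cases "j = Suc k") (auto simp: p'_def c_def d_def r_def H')
  qed (simp add: H')
  with act' have "step n i ?G p' (sigma n k H')" by (simp add: step_def)
  moreover have "int (local_energy n k H') =
      int (local_energy n k H) + of_bool (i = 0) * (of_bool (p = Suc k) - of_bool (p' = k))"
    using w'(2) u(2) p assms(6) by (auto simp: p'_def)
  ultimately show ?thesis by blast
qed

lemma step_sigma:
  assumes "is_tensor n H" "2 \<le> n" "Suc k < length H" "i < n" "step n i H p H'"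
  shows "\<exists>p'. step n i (sigma n k H) p' (sigma n k H') \<and>
    int (local_energy n k H') = int (local_energy n k H) + of_bool (i = 0) * (of_bool (p = Suc k) - of_bool (p' = k))"
  using step_sigma_outside[OF assms] step_sigma_inside[OF assms]
  by (cases "p = k \<or> p = Suc k") auto

section \<open>Moving a factor to the right end\<close>

abbreviation move_factor :: "nat \<Rightarrow> nat \<Rightarrow> nat \<Rightarrow> row_tensor \<Rightarrow> row_tensor" where
  "move_factor n t j \<equiv> foldr (sigma n) [t..<j]"

lemma move_factor_Suc: "t < j \<Longrightarrow> move_factor n t j H = sigma n t (move_factor n (Suc t) j H)"
  by (simp add: upt_conv_Cons)

lemma move_factor_induct [consumes 2, case_names base step]:
  assumes "t \<le> j" "j < length H"
    and "P H"
    and "\<And>k G. Suc k < length H \<Longrightarrow> length G = length H \<Longrightarrow> P G \<Longrightarrow> P (sigma n k G)"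
  shows "P (move_factor n t j H)"
proof -
  have "P (move_factor n t j H) \<and> length (move_factor n t j H) = length H"
    using assms(1)
  proof (induction t rule: inc_induct)
    case (step t)
    then show ?case using assms(2,4) by (simp add: move_factor_Suc)
  qed (use assms(3) in simp)
  then show ?thesis ..
qed

lemma is_tensor_move_factor:
  assumes "is_tensor n H" "2 \<le> n" "t \<le> j" "j < length H"
  shows "is_tensor n (move_factor n t j H)" "length (move_factor n t j H) = length H"
proof -
  show "is_tensor n (move_factor n t j H)"
    using assms(3,4) by (induction rule: move_factor_induct) (use assms is_tensor_sigma in auto)
  show "length (move_factor n t j H) = length H"
    using assms(3,4) by (induction rule: move_factor_induct) auto
qed

text \<open>The winding numbers of the moving factor telescope: each one changes by the indicator that \<open>f\<^sub>0\<close>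
  hits the moving factor before the transposition minus the same indicator after it.\<close>

lemma step_move_factor:
  assumes "is_tensor n H" "2 \<le> n" "i < n" "step n i H p H'" "t \<le> j" "j < length H"
  shows "\<exists>p'. step n i (move_factor n t j H) p' (move_factor n t j H') \<and>
    (\<Sum>s\<in>{t..<j}. int (local_energy n s (move_factor n (Suc s) j H'))) =
    (\<Sum>s\<in>{t..<j}. int (local_energy n s (move_factor n (Suc s) j H))) +
      of_bool (i = 0) * (of_bool (p = j) - of_bool (p' = t))"
  using assms(5)
proof (induction t rule: inc_induct)
  case base
  then show ?case using assms(4) by (intro exI[of _ p]) simp
next
  case (step t)
  let ?G = "move_factor n (Suc t) j H" and ?G' = "move_factor n (Suc t) j H'"
  obtain p1 where p1: "step n i ?G p1 ?G' \<and> (\<Sum>s\<in>{Suc t..<j}. int (local_energy n s (move_factor n (Suc s) j H'))) = (\<Sum>s\<in>{Suc t..<j}. int (local_energy n s (move_factor n (Suc s) j H))) + of_bool (i = 0) * (of_bool (p = j) - of_bool (p1 = Suc t))"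
    using step.IH by auto
  note G = is_tensor_move_factor[OF assms(1,2) Suc_leI[OF step.hyps(2)] assms(6)]
  obtain p' where p': "step n i (sigma n t ?G) p' (sigma n t ?G')"
    "int (local_energy n t ?G') = int (local_energy n t ?G) + of_bool (i = 0) * (of_bool (p1 = Suc t) - of_bool (p' = t))"
    using step_sigma[OF G(1) assms(2) _ assms(3) conjunct1[OF p1], of t] G(2) step.hyps assms(6) by auto
  show ?case
    using p1 p' step.hyps
    by (intro exI[of _ p']) (auto simp: move_factor_Suc sum.atLeast_Suc_lessThan algebra_simps)
qed

text \<open>Moving factor \<open>j\<close> contributes [p = j] - [p' = 0] to the change under f_0,
  where \<open>p'\<close> is the factor hit after the move. The assumption excludes
  \<open>p' = 0\<close>, and \<open>p = j\<close> holds for exactly one \<open>j\<close>. For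
  \<open>i > 0\<close> every contribution vanishes.\<close>

lemma step_energy:
  assumes "is_tensor n H" "2 \<le> n" "i < n" "step n i H p H'"
    and "i = 0 \<Longrightarrow> \<forall>j<length H. n \<notin> set (move_factor n 0 j H ! 0)"
  shows "energy n H' = energy n H + of_bool (i = 0)"
proof -
  have H': "length H' = length H" "p < length H" using step_tensor[OF assms(4,1,3)] by auto
  have "(\<Sum>s<j. int (local_energy n s (move_factor n (Suc s) j H'))) =
    (\<Sum>s<j. int (local_energy n s (move_factor n (Suc s) j H))) + of_bool (i = 0) * of_bool (p = j)"
    if j: "j < length H" for j
  proof -
    obtain p' where p': "step n i (move_factor n 0 j H) p' (move_factor n 0 j H')"
      "(\<Sum>s\<in>{0..<j}. int (local_energy n s (move_factor n (Suc s) j H'))) =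
       (\<Sum>s\<in>{0..<j}. int (local_energy n s (move_factor n (Suc s) j H))) +
         of_bool (i = 0) * (of_bool (p = j) - of_bool (p' = 0))"
      using step_move_factor[OF assms(1-4) _ j, of 0] by auto
    have "p' \<noteq> 0" if "i = 0"
    proof
      assume "p' = 0"
      with p'(1) that have "0 < cnt (move_factor n 0 j H ! 0) n"
        by (auto simp: step_def acts_def closing_letter_def)
      then show False using assms(5)[OF that] j by simp
    qed
    with p'(2) show ?thesis by (cases "i = 0") (simp_all add: lessThan_atLeast0)
  qed
  then have "int (energy n H') = int (energy n H) + (\<Sum>j<length H. of_bool (i = 0) * of_bool (p = j))"
    unfolding energy_def H'(1) of_nat_sum sum.distrib[symmetric] by (intro sum.cong) auto
  also have "(\<Sum>j<length H. of_bool (i = 0) * of_bool (p = j)) = (of_bool (i = 0) :: int)"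
    using H'(2) by (simp add: of_bool_def)
  finally show ?thesis by (cases "i = 0") simp_all
qed

subsection \<open>Connecting an element to a regular 0-arrow\<close>

definition classical_edge :: "nat \<Rightarrow> row_tensor \<Rightarrow> row_tensor \<Rightarrow> bool" where
  "classical_edge n H H' \<longleftrightarrow> is_tensor n H \<and> (\<exists>i p. 1 \<le> i \<and> i < n \<and> step n i H p H')"

definition classically_linked :: "nat \<Rightarrow> row_tensor \<Rightarrow> row_tensor \<Rightarrow> bool" where
  "classically_linked n = equivclp (classical_edge n)"

definition same_energy_rows :: "nat \<Rightarrow> row_tensor \<Rightarrow> row_tensor \<Rightarrow> bool" where
  "same_energy_rows n H H' \<longleftrightarrow> is_tensor n H' \<and> map length H' = map length H \<and> energy n H' = energy n H"

lemma classically_linked_same: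
  assumes "classically_linked n H H'" "is_tensor n H" "2 \<le> n"
  shows "same_energy_rows n H H'"
  using assms(1) unfolding classically_linked_def equivclp_def
proof (induction rule: rtranclp_induct)
  case base
  show ?case using assms(2) by (simp add: same_energy_rows_def)
next
  case (step G G')
  have same: "same_energy_rows n K K'" if edge: "classical_edge n K K'" for K K'
  proof -
    obtain i p where i: "1 \<le> i" "i < n" "step n i K p K'" and K: "is_tensor n K"
      using edge by (auto simp: classical_edge_def)
    show ?thesis
      using step_tensor(1,2)[OF i(3) K i(2)] step_energy[OF K assms(3) i(2,3)] i(1)
      by (simp add: same_energy_rows_def)
  qed
  from step.hyps(2) have "same_energy_rows n G G' \<or> is_tensor n G' \<and> same_energy_rows n G' G"
    using same unfolding symclp_def classical_edge_def by blast
  with step.IH show ?case by (auto simp: same_energy_rows_def)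
qed

lemma classically_linked_refl: "classically_linked n H H"
  by (simp add: classically_linked_def equivclp_def)

lemma classically_linked_trans:
  "classically_linked n H G \<Longrightarrow> classically_linked n G K \<Longrightarrow> classically_linked n H K"
  unfolding classically_linked_def by (rule equivclp_trans)

lemma classically_linked_edge:
  assumes "classical_edge n H H'"
  shows "classically_linked n H H'" "classically_linked n H' H"
  using assms unfolding classically_linked_def equivclp_def by (auto simp: symclp_def)

definition is_highest :: "nat \<Rightarrow> row_tensor \<Rightarrow> bool" where
  "is_highest n H \<longleftrightarrow> (\<forall>i. 1 \<le> i \<and> i < n \<longrightarrow> highest n i H)"

lemma classically_linked_highest:
  assumes "is_tensor n H" "2 \<le> n"
  shows "\<exists>G. classically_linked n H G \<and> is_highest n G"
  using assms(1)
proof (induction "sum_list (map sum_list H)" arbitrary: H rule: less_induct)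
  case less
  show ?case
  proof (cases "is_highest n H")
    case True
    then show ?thesis using classically_linked_refl by blast
  next
    case False
    then obtain i where i: "1 \<le> i" "i < n" "\<not> highest n i H" by (auto simp: is_highest_def)
    obtain p H' where H': "step n i H' p H" "is_tensor n H'" "sum_list (map sum_list H') < sum_list (map sum_list H)"
      using step_into[OF less.prems assms(2) i] by blast
    then have "classical_edge n H' H" using i by (auto simp: classical_edge_def)
    then have "classically_linked n H H'" by (rule classically_linked_edge)
    with less.hyps[OF H'(3,2)] show ?thesis by (blast intro: classically_linked_trans)
  qed
qed

section \<open>Replacing a letter by its absent successor in a tensor\<close>

definition shift_letter :: "nat \<Rightarrow> nat \<Rightarrow> nat" where
  "shift_letter t x = (if x = t then Suc t else x)"

definition shift :: "nat \<Rightarrow> row_tensor \<Rightarrow> row_tensor" where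
  "shift t H = map (map (shift_letter t)) H"

lemma is_row_shift: "is_row n h \<Longrightarrow> t < n \<Longrightarrow> is_row n (map (shift_letter t) h)"
  by (auto simp: is_row_def shift_letter_def sorted_map intro!: sorted_wrt_mono_rel[of h "(\<le>)"])

lemma is_tensor_shift: "is_tensor n H \<Longrightarrow> t < n \<Longrightarrow> is_tensor n (shift t H)"
  using is_row_shift by (auto simp: is_tensor_def shift_def)

lemma cnt_shift: "Suc t \<notin> set h \<Longrightarrow> cnt (map (shift_letter t) h) = shift_counts t (cnt h)"
  by (induction h) (auto simp: shift_counts_def shift_letter_def fun_eq_iff)

text \<open>The assumption that every \<open>t\<close> is unmatched follows from the absence of
  \<open>t + 1\<close> and, unlike that absence, survives an f_t arrow, since both sides drop by
  one.\<close>

lemma classically_linked_shift_aux: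
  assumes "is_tensor n H" "1 \<le> t" "t < n"
    and "phi n t H (length H) = (\<Sum>h\<leftarrow>H. cnt h t)"
  shows "classically_linked n H (shift t H)"
  using assms(1,4)
proof (induction "phi n t H (length H)" arbitrary: H)
  case 0
  then have "map (shift_letter t) h = h" if "h \<in> set H" for h
    using that by (intro map_idI) (auto simp: shift_letter_def sum_list_eq_0_iff)
  then have "shift t H = H" by (simp add: shift_def map_idI)
  then show ?case by (simp add: classically_linked_refl)
next
  case (Suc m)
  have n: "2 \<le> n" using assms by simp
  have cl: "closing_letter n t = t" using assms by (simp add: closing_letter_def)
  obtain p where "acts n t H p" using acts_exists Suc.hyps(2) by (metis zero_less_Suc)
  define H' where "H' = H[p := raise_row n t (H ! p)]"
  have st: "step n t H p H'" using \<open>acts n t H p\<close> by (simp add: step_def H'_def)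
  note H' = step_tensor[OF st Suc.prems(1) assms(3)]
  have pos: "0 < cnt (H ! p) t" using \<open>acts n t H p\<close> by (simp add: acts_def cl)
  have row: "is_row n (H ! p)" using is_tensor_nth[OF Suc.prems(1) H'(4)] .
  have phi': "phi n t H' (length H') = m"
    using phi_step[OF st n assms(3) H'(4)] Suc.hyps(2) H'(3) by simp
  have sum': "Suc (\<Sum>h\<leftarrow>H'. cnt h t) = (\<Sum>h\<leftarrow>H. cnt h t)"
  proof -
    have "cnt (raise_row n t (H ! p)) t = cnt (H ! p) t - 1"
      using cnt_raise_row[OF n assms(3), of "H ! p"] pos by (simp add: cl raise_counts_def)
    moreover have "cnt (H ! p) t \<le> (\<Sum>h\<leftarrow>H. cnt h t)"
      using H'(4) by (intro member_le_sum_list) auto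
    moreover have "(\<Sum>h\<leftarrow>H'. cnt h t) = (\<Sum>h\<leftarrow>H. cnt h t) + cnt (raise_row n t (H ! p)) t - cnt (H ! p) t"
      using H'(4) by (simp add: H'_def map_update sum_list_update)
    ultimately show ?thesis using pos by linarith
  qed
  have shift': "shift t H' = shift t H"
  proof -
    have "mset (map (shift_letter t) (raise_row n t (H ! p))) = mset (map (shift_letter t) (H ! p))"
    proof -
      have "mset (H ! p) = add_mset t (mset (H ! p) - {#t#})" using pos by simp
      then have "image_mset (shift_letter t) (mset (H ! p)) = add_mset (Suc t) (image_mset (shift_letter t) (mset (H ! p) - {#t#}))"
        by (metis image_mset_add_mset shift_letter_def)
      then show ?thesis by (simp add: mset_raise_row cl shift_letter_def)
    qed
    then have "map (shift_letter t) (raise_row n t (H ! p)) = map (shift_letter t) (H ! p)"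
      using is_row_shift[OF row assms(3)] is_row_shift[OF is_row_raise_row[OF row assms(3)] assms(3)]
      by (metis is_row_def properties_for_sort)
    then show ?thesis using H'(4) by (simp add: shift_def H'_def map_update list_update_same_conv)
  qed
  have link: "classically_linked n H H'"
    using st Suc.prems assms by (intro classically_linked_edge) (auto simp: classical_edge_def)
  have "m = (\<Sum>h\<leftarrow>H'. cnt h t)" using sum' Suc.hyps(2) Suc.prems(2) by linarith
  then have "classically_linked n H' (shift t H')"
    using Suc.hyps(1)[of H'] phi' H'(1) by simp
  with link show ?case unfolding shift' by (rule classically_linked_trans)
qed

definition letters :: "row_tensor \<Rightarrow> nat set" where
  "letters H = (\<Union>h\<in>set H. set h)"

lemma letters_bounds: "is_tensor n H \<Longrightarrow> letters H \<subseteq> {1..n}"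
  by (auto simp: letters_def is_tensor_def is_row_def)

lemma letters_shift: "letters (shift t H) = shift_letter t ` letters H"
  by (auto simp: letters_def shift_def)

lemma phi_no_opening:
  assumes "Suc i \<notin> letters H" "j \<le> length H"
  shows "phi n i H j = (\<Sum>h\<leftarrow>take j H. cnt h (closing_letter n i))"
  using assms(2)
proof (induction j)
  case (Suc j)
  then have "Suc i \<notin> set (H ! j)" using assms(1) by (auto simp: letters_def)
  then have "cnt (H ! j) (Suc i) = 0" by simp
  with Suc show ?case by (simp only: phi.simps) (simp add: take_Suc_conv_app_nth)
qed simp

lemma classically_linked_shift:
  assumes "is_tensor n H" "1 \<le> t" "t < n" "Suc t \<notin> letters H"
  shows "classically_linked n H (shift t H)"
  using assms phi_no_opening[OF assms(4), of "length H" n]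
  by (intro classically_linked_shift_aux) (auto simp: closing_letter_def)

lemma sigma_shift:
  assumes "is_tensor n H" "2 \<le> n" "Suc k < length H" "1 \<le> t" "t < n" "Suc t \<notin> letters H"
  shows "sigma n k (shift t H) = shift t (sigma n k H)" "Suc t \<notin> letters (sigma n k H)"
proof -
  let ?G = "sigma n k H" and ?f = "map (shift_letter t)"
  have n: "1 \<le> n" using assms by simp
  obtain x y where R: "R_matrix n (H ! Suc k, H ! k) = (x, y)" by fastforce
  have tG: "is_tensor n ?G" by (rule is_tensor_sigma[OF assms(1) n assms(3)])
  have H0: "cnt (H ! j) (Suc t) = 0" if "j < length H" for j
    using assms(6) that by (auto simp: letters_def)
  have G0: "cnt (?G ! j) (Suc t) = 0" if j: "j < length H" for j
  proof (cases "j = k \<or> j = Suc k")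
    case True
    have "cnt (?G ! Suc k) (Suc t) + cnt (?G ! k) (Suc t) = 0"
      using sigma_content[OF assms(1) n assms(3), of "Suc t"] H0[of k] H0[of "Suc k"] assms(3,5)
      by simp
    with True show ?thesis by auto
  next
    case False
    then show ?thesis using H0[OF j] sigma_nth(3)[OF R assms(3), of j] by simp
  qed
  then show "Suc t \<notin> letters ?G" by (auto simp: letters_def in_set_conv_nth)
  have cnt: "cnt (?f (H ! k)) = shift_counts t (cnt (H ! k))" "cnt (?f (H ! Suc k)) = shift_counts t (cnt (H ! Suc k))"
    "cnt (?f (?G ! k)) = shift_counts t (cnt (?G ! k))" "cnt (?f (?G ! Suc k)) = shift_counts t (cnt (?G ! Suc k))"
    using H0[OF Suc_lessD[OF assms(3)]] H0[OF assms(3)] G0[OF Suc_lessD[OF assms(3)]] G0[OF assms(3)]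
    unfolding count_mset_0_iff by (simp_all only: cnt_shift not_False_eq_True)
  have "\<exists>w. R_graph n (?f (H ! Suc k)) (?f (H ! k)) (?f (?G ! Suc k)) (?f (?G ! k)) w"
  proof (cases "length (H ! Suc k) \<le> length (H ! k)")
    case True
    then obtain q where "qsol n (cnt (H ! Suc k)) (cnt (H ! k)) (cnt (?G ! Suc k)) (cnt (?G ! k)) q"
      using sigma_graph[OF assms(1) n assms(3)] by (auto simp: R_graph_def)
    from qsol_shift[OF this assms(4,5) H0 H0] True assms(3) sigma_graph[OF assms(1) n assms(3)]
    show ?thesis unfolding R_graph_def cnt by auto
  next
    case False
    then obtain q where "qsol n (cnt (?G ! Suc k)) (cnt (?G ! k)) (cnt (H ! Suc k)) (cnt (H ! k)) q"
      using sigma_graph[OF assms(1) n assms(3)] by (auto simp: R_graph_def)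
    from qsol_shift[OF this assms(4,5) G0 G0] False assms(3) sigma_graph[OF assms(1) n assms(3)]
    show ?thesis unfolding R_graph_def cnt by auto
  qed
  then obtain w where w: "R_graph n (shift t H ! Suc k) (shift t H ! k) (?f (?G ! Suc k)) (?f (?G ! k)) w"
    using assms(3) by (auto simp: shift_def)
  have rows: "is_row n (?f (?G ! Suc k))" "is_row n (?f (?G ! k))"
    using is_tensor_nth[OF tG] is_row_shift assms(3,5) by auto
  have "sigma n k (shift t H) = (shift t H)[Suc k := ?f (?G ! Suc k), k := ?f (?G ! k)]"
    using sigma_unique(1)[OF is_tensor_shift[OF assms(1,5)] rows n _ w] assms(3) by (simp add: shift_def)
  also have "\<dots> = shift t ?G"
    using sigma_nth[OF R assms(3)] R assms(3) by (simp add: shift_def sigma_def map_update)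
  finally show "sigma n k (shift t H) = shift t ?G" .
qed

lemma move_factor_shift:
  assumes "is_tensor n H" "2 \<le> n" "1 \<le> t" "t < n" "Suc t \<notin> letters H" "s \<le> j" "j < length H"
  shows "move_factor n s j (shift t H) = shift t (move_factor n s j H)"
proof -
  have "move_factor n s j (shift t H) = shift t (move_factor n s j H) \<and> Suc t \<notin> letters (move_factor n s j H)"
    using assms(6)
  proof (induction s rule: inc_induct)
    case (step s)
    note G = is_tensor_move_factor[OF assms(1,2) Suc_leI[OF step.hyps(2)] assms(7)]
    have "Suc s < length (move_factor n (Suc s) j H)" using G(2) step.hyps assms(7) by simp
    from sigma_shift[OF G(1) assms(2) this assms(3,4)] step.IH step.hyps show ?case
      by (simp add: move_factor_Suc)
  qed (use assms in simp)
  then show ?thesis ..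
qed

text \<open>R preserves the highest weight property, and \<open>phi\<close> is 0 at the rightmost
  factor, so no letter \<open>Suc i\<close> with \<open>1 <= i\<close> can be matched there.\<close>

lemma highest_move_factor:
  assumes "is_tensor n H" "2 \<le> n" "is_highest n H" "j < length H"
  shows "set (move_factor n 0 j H ! 0) \<subseteq> {1}"
proof -
  let ?G = "move_factor n 0 j H"
  have "is_tensor n ?G \<and> is_highest n ?G"
    using le0 assms(4)
  proof (induction rule: move_factor_induct)
    case base
    show ?case using assms by simp
  next
    case (step k G)
    then show ?case using highest_sigma[of n G k] is_tensor_sigma[of n G k] assms(2)
      by (simp add: is_highest_def)
  qed
  moreover have len: "0 < length ?G" using is_tensor_move_factor(2)[OF assms(1,2) _ assms(4), of 0] assms(4) by linarith
  ultimately have notin: "Suc i \<notin> set (?G ! 0)" if "1 \<le> i" "i < n" for i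
    using that unfolding is_highest_def highest_def by (metis count_mset_0_iff le_zero_eq phi.simps(1))
  have sub: "set (?G ! 0) \<subseteq> {1..n}"
    using \<open>is_tensor n ?G \<and> is_highest n ?G\<close> is_tensor_nth[of n ?G 0] len by (auto simp: is_row_def)
  have "x = 1" if "x \<in> set (?G ! 0)" for x
  proof (rule ccontr)
    assume "x \<noteq> 1"
    moreover have "x \<in> {1..n}" using that sub by blast
    ultimately have "1 \<le> x - 1" "x - 1 < n" "Suc (x - 1) = x" by auto
    with notin[of "x - 1"] that show False by simp
  qed
  then show ?thesis by blast
qed

section \<open>Existence of regular 0-arrows\<close>

definition regular_arrow :: "nat \<Rightarrow> row_tensor \<Rightarrow> row_tensor \<Rightarrow> bool" where
  "regular_arrow n H H' \<longleftrightarrow> (\<exists>p. step n 0 H p H') \<and> energy n H' = energy n H + 1"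

lemma regular_arrowI:
  assumes "is_tensor n H" "2 \<le> n" "0 < phi n 0 H (length H)"
    and "\<And>j. j < length H \<Longrightarrow> set (move_factor n 0 j H ! 0) \<subseteq> {z}" "z < n"
  shows "\<exists>H'. regular_arrow n H H'"
proof -
  obtain p where "acts n 0 H p" using acts_exists[OF assms(3)] by blast
  then have st: "step n 0 H p (H[p := raise_row n 0 (H ! p)])" by (simp add: step_def)
  have "energy n (H[p := raise_row n 0 (H ! p)]) = energy n H + 1"
    using step_energy[OF assms(1,2) _ st] assms(2,4,5) by fastforce
  with st show ?thesis by (auto simp: regular_arrow_def)
qed

text \<open>Replacing a letter \<open>t\<close> by an absent letter \<open>t + 1\<close> stays inside the classical component and commutes
  with the R-matrix.  Such replacements are made until \<open>n\<close> occurs and \<open>1\<close> does not: then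
  \<open>f\<^sub>0\<close> acts, because no \<open>n\<close> is matched.\<close>

lemma regular_arrow_absent:
  assumes "is_tensor n H" "2 \<le> n" "\<not> {1..n} \<subseteq> letters H"
    and "M \<in> letters H" "z < M" "\<And>j. j < length H \<Longrightarrow> set (move_factor n 0 j H ! 0) \<subseteq> {z}"
  shows "\<exists>G G'. classically_linked n H G \<and> regular_arrow n G G'"
  using assms(1,3-6)
proof (induction "\<Sum>x\<in>letters H. n - x" arbitrary: H M z rule: less_induct)
  case less
  note H = less.prems(1)
  note bounds = letters_bounds[OF H]
  have fin: "finite (letters H)" by (simp add: letters_def)
  \<comment> \<open>A replacement trades \<open>t\<close> for \<open>t + 1\<close> in the set of
    letters, which lowers the measure and leaves \<open>t\<close> as an absent letter.
    \<open>M'\<close> again exceeds the letter of the moved factors, which keeps that letter below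
    \<open>n\<close>.\<close>
  have shift: ?case
    if t: "t \<in> letters H" "Suc t \<notin> letters H" "t < n" "shift_letter t z < M'" "M' \<in> shift_letter t ` letters H" for t M'
  proof -
    let ?S = "shift t H"
    have t1: "1 \<le> t" using t(1) bounds by auto
    have link: "classically_linked n H ?S" by (rule classically_linked_shift[OF H t1 t(3,2)])
    have L: "letters ?S = insert (Suc t) (letters H - {t})"
      using t(1) unfolding letters_shift by (auto simp: shift_letter_def)
    have "(\<Sum>x\<in>letters ?S. n - x) < (\<Sum>x\<in>letters H. n - x)"
      unfolding L using fin t by (simp add: sum.remove[of "letters H" t])
    moreover have "\<not> {1..n} \<subseteq> letters ?S" using t1 t(3) unfolding L by (auto simp: subset_iff intro!: exI[of _ t])
    moreover have "set (move_factor n 0 j ?S ! 0) \<subseteq> {shift_letter t z}" if j: "j < length ?S" for j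
    proof -
      have j': "j < length H" using j by (simp add: shift_def)
      have len: "length (move_factor n 0 j H) = length H" by (rule is_tensor_move_factor(2)[OF H assms(2) le0 j'])
      then have "0 < length (move_factor n 0 j H)" using j' by linarith
      then show ?thesis
        using less.prems(5)[OF j'] unfolding move_factor_shift[OF H assms(2) t1 t(3,2) le0 j'] 
        by (auto simp: shift_def)
    qed
    ultimately obtain G G' where "classically_linked n ?S G \<and> regular_arrow n G G'"
      using less.hyps[of ?S M' "shift_letter t z"] is_tensor_shift[OF H t(3)] t(4,5) letters_shift by metis
    with link show ?thesis by (blast intro: classically_linked_trans)
  qed
  have M: "1 \<le> M" "M \<le> n" using less.prems(3) bounds by auto
  show ?case
  proof (cases "n \<in> letters H")
    case False
    \<comment> \<open>The largest letter is pushed towards \<open>n\<close>. As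
      \<open>z < M <= ?t\<close>, the letter of the moved factors does not change.\<close>
    let ?t = "Max (letters H)"
    have t: "?t \<in> letters H" "M \<le> ?t" using fin less.prems(3) by (auto intro: Max_in)
    then have "Suc ?t \<notin> letters H" using Max_ge[OF fin] by (metis Suc_n_not_le_n)
    moreover have "?t < n" using t(1) bounds False by (metis atLeastAtMost_iff le_neq_implies_less subset_iff)
    moreover have "shift_letter ?t z < Suc ?t" using t(2) less.prems(4) by (simp add: shift_letter_def)
    ultimately show ?thesis using shift[of ?t "Suc ?t"] t(1) by (force simp: shift_letter_def)
  next
    case n: True
    show ?thesis
    proof (cases "1 \<in> letters H")
      case False
      then have "phi n 0 H (length H) = (\<Sum>h\<leftarrow>H. cnt h n)"
        using phi_no_opening[of 0 H "length H" n] by (simp add: closing_letter_def)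
      moreover have "\<dots> \<noteq> 0" using n by (auto simp: letters_def sum_list_eq_0_iff)
      ultimately have "0 < phi n 0 H (length H)" by linarith
      then obtain H' where "regular_arrow n H H'"
        using regular_arrowI[OF H assms(2), of z] less.prems(4,5) M(2) by auto
      then show ?thesis using classically_linked_refl by blast
    next
      case True
      \<comment> \<open>Shifting the letter just below the least absent one moves the gap down by
        one, until 1 is absent. Since \<open>n\<close> occurs, the gap is below \<open>n\<close>, so
        \<open>n\<close> remains a letter above the shifted \<open>z\<close>.\<close>
      define y where "y = (LEAST y. 1 \<le> y \<and> y \<notin> letters H)"
      obtain y0 where "y0 \<in> {1..n}" "y0 \<notin> letters H" using less.prems(2) by blast
      then have y0: "1 \<le> y0" "y0 \<notin> letters H" "y0 \<le> n" by auto
      have y: "1 \<le> y \<and> y \<notin> letters H" unfolding y_def by (rule LeastI[of _ y0]) (use y0 in simp)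
      have le: "y \<le> v" if "1 \<le> v" "v \<notin> letters H" for v
        unfolding y_def by (rule Least_le) (use that in simp)
      then have "y \<le> n" using y0 by (meson order_trans)
      then have yn: "y < n" using n y by (metis le_neq_implies_less)
      have "y \<noteq> 1" using y True by auto
      then obtain t where t: "y = Suc t" "1 \<le> t" using y by (cases y) auto
      then have "t \<in> letters H" using le[of t] by auto
      moreover have "shift_letter t z < n" using yn t M less.prems(4) by (auto simp: shift_letter_def)
      moreover have "n \<in> shift_letter t ` letters H" using n yn t(1) by (force simp: shift_letter_def)
      ultimately show ?thesis using shift[of t n] y t(1) yn by auto
    qed
  qed
qed

lemma phi_pos: "0 < phi n i H j \<Longrightarrow> \<exists>s<j. closing_letter n i \<in> set (H ! s)"
proof (induction j)
  case (Suc j)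
  show ?case
  proof (cases "closing_letter n i \<in> set (H ! j)")
    case False
    then have "cnt (H ! j) (closing_letter n i) = 0" by simp
    with Suc.prems have "0 < phi n i H j" by simp
    with Suc.IH show ?thesis by (metis less_SucI)
  qed auto
qed simp

text \<open>A letter \<open>i + 1\<close> with \<open>1 <= i\<close> must be matched by an
  \<open>i\<close> in a factor of smaller index; descending to 1 produces \<open>x\<close> distinct
  nonempty factors.\<close>

lemma highest_letter_bound:
  assumes "is_highest n H" "1 \<le> x" "x \<le> n" "j < length H" "x \<in> set (H ! j)"
  shows "x \<le> card {s. s \<le> j \<and> H ! s \<noteq> []}"
  using assms(2-5)
proof (induction x arbitrary: j)
  case (Suc i)
  have fin: "finite {s. s \<le> j \<and> H ! s \<noteq> []}" by simp
  have mem: "j \<in> {s. s \<le> j \<and> H ! s \<noteq> []}" using Suc.prems by auto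
  show ?case
  proof (cases "i = 0")
    case True
    then show ?thesis using fin mem by (metis One_nat_def Suc_leI card_gt_0_iff empty_iff)
  next
    case False
    then have i: "1 \<le> i" "i < n" using Suc.prems by auto
    have "0 < cnt (H ! j) (Suc i)" using Suc.prems(4) by simp
    also have "cnt (H ! j) (Suc i) \<le> phi n i H j"
      using assms(1) i Suc.prems(3) unfolding is_highest_def highest_def by blast
    finally obtain s where s: "s < j" "i \<in> set (H ! s)"
      using phi_pos[of n i H j] i by (auto simp: closing_letter_def)
    have "i \<le> card {r. r \<le> s \<and> H ! r \<noteq> []}" using Suc.IH[of s] i s Suc.prems by simp
    moreover have "{r. r \<le> s \<and> H ! r \<noteq> []} \<subset> {s. s \<le> j \<and> H ! s \<noteq> []}"
    proof (rule psubsetI)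
      show "{r. r \<le> s \<and> H ! r \<noteq> []} \<noteq> {s. s \<le> j \<and> H ! s \<noteq> []}"
      proof -
        have "j \<notin> {r. r \<le> s \<and> H ! r \<noteq> []}" using s(1) by simp
        with mem show ?thesis by blast
      qed
    qed (use s(1) in auto)
    then have "card {r. r \<le> s \<and> H ! r \<noteq> []} < card {s. s \<le> j \<and> H ! s \<noteq> []}"
      by (rule psubset_card_mono[OF fin])
    ultimately show ?thesis by linarith
  qed
qed simp

lemma regular_arrow_full:
  assumes "is_tensor n H" "2 \<le> n" "is_highest n H" "n \<in> letters H"
    and "length (filter (\<lambda>m. m \<noteq> 0) (map length H)) \<le> n"
  shows "\<exists>H'. regular_arrow n H H'"
proof -
  let ?N = "\<lambda>j. {s. s \<le> j \<and> H ! s \<noteq> []}" and ?A = "{s. s < length H \<and> H ! s \<noteq> []}"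
  have A: "card ?A \<le> n"
  proof -
    have "{i. i < length (map length H) \<and> map length H ! i \<noteq> 0} = ?A" by auto
    then show ?thesis using assms(5) unfolding length_filter_conv_card by (simp only:)
  qed
  \<comment> \<open>A factor containing \<open>n\<close> already has \<open>n\<close> nonempty
    factors up to and including itself, and there are no more.\<close>
  have later: "H ! s = []" if "n \<in> set (H ! j)" "j < s" "s < length H" for j s
  proof (rule ccontr)
    assume "H ! s \<noteq> []"
    then have "s \<in> ?A" "s \<notin> ?N j" using that by auto
    moreover have "?N j \<subseteq> ?A" using that by auto
    ultimately have "?N j \<subset> ?A" by blast
    then have "card (?N j) < card ?A" by (intro psubset_card_mono) auto
    with highest_letter_bound[OF assms(3) _ _ _ that(1)] that assms(2) A show False by simp
  qed
  obtain p where p: "p < length H" "n \<in> set (H ! p)"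
    using assms(4) unfolding letters_def by (metis UN_E in_set_conv_nth)
  have cl: "closing_letter n 0 = n" by (simp add: closing_letter_def)
  \<comment> \<open>Empty factors bring no opening letter 1, so the closing brackets of factor
    \<open>p\<close> survive to the end.\<close>
  have "phi n 0 H j > 0" if "Suc p \<le> j" "j \<le> length H" for j
    using that
  proof (induction j rule: dec_induct)
    case base
    show ?case using p by (simp add: cl)
  next
    case (step j)
    then show ?case using later[OF p(2), of j] by simp
  qed
  then have "0 < phi n 0 H (length H)" using p by simp
  then show ?thesis
    using regular_arrowI[OF assms(1,2) _ highest_move_factor[OF assms(1-3)]] assms(2) by fastforce
qed

section \<open>Connectedness\<close>

lemma finite_row_tensors: "finite (row_tensors n \<mu>)"
proof -
  have "row_tensors n \<mu> \<subseteq> {H. set H \<subseteq> (\<Union>k\<in>set \<mu>. row_words n k) \<and> length H = length \<mu>}"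
    by (fastforce simp: row_tensors_def in_set_conv_nth)
  then show ?thesis
    by (rule finite_subset) (intro finite_lists_length_eq finite_UN_I finite_set finite_row_words)
qed

definition regular_edge :: "nat \<Rightarrow> row_tensor \<Rightarrow> row_tensor \<Rightarrow> bool" where
  "regular_edge n H H' \<longleftrightarrow> is_tensor n H \<and>
    (\<exists>i p. i < n \<and> step n i H p H' \<and> (i = 0 \<longrightarrow> energy n H' = energy n H + 1))"

lemma classically_linked_regular:
  "classically_linked n H H' \<Longrightarrow> equivclp (regular_edge n) H H'"
  unfolding classically_linked_def equivclp_def
  by (erule rtranclp_mono[THEN predicate2D, rotated])
    (fastforce simp: symclp_def classical_edge_def regular_edge_def)

lemma linked_to_single_row:
  assumes "2 \<le> n" "length (filter (\<lambda>m. m \<noteq> 0) \<mu>) \<le> n" "H \<in> row_tensors n \<mu>"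
  shows "equivclp (regular_edge n) H (map (\<lambda>m. replicate m 1) \<mu>)"
  using assms(3)
\<comment> \<open>There are finitely many tensors, so the energy is bounded and its distance to the
  maximum serves as the measure.\<close>
proof (induction "Max (energy n ` row_tensors n \<mu>) - energy n H" arbitrary: H rule: less_induct)
  case less
  have H: "is_tensor n H" "map length H = \<mu>" using less.prems by (auto simp: row_tensors_iff)
  obtain G where HG: "classically_linked n H G" "is_highest n G"
    using classically_linked_highest[OF H(1) assms(1)] by blast
  have G: "is_tensor n G" "map length G = \<mu>" "energy n G = energy n H"
    using classically_linked_same[OF HG(1) H(1) assms(1)] H(2) by (auto simp: same_energy_rows_def)
  show ?case
  proof (cases "letters G \<subseteq> {1}")
    case True
    have "G = map (\<lambda>m. replicate m 1) (map length G)"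
    proof (rule nth_equalityI)
      fix j assume j: "j < length G"
      then have "set (G ! j) \<subseteq> {1}" using True nth_mem[OF j] unfolding letters_def by blast
      then have "G ! j = replicate (length (G ! j)) 1" by (metis replicate_eqI singletonD subsetD)
      then show "G ! j = map (\<lambda>m. replicate m 1) (map length G) ! j" using j by simp
    qed simp
    then have "G = map (\<lambda>m. replicate m 1) \<mu>" using G(2) by simp
    with classically_linked_regular[OF HG(1)] show ?thesis by simp
  next
    case False
    have "\<exists>K K'. classically_linked n G K \<and> regular_arrow n K K'"
    proof (cases "{1..n} \<subseteq> letters G")
      case True
      then have "n \<in> letters G" using assms(1) by auto
      from regular_arrow_full[OF G(1) assms(1) HG(2) this] assms(2) G(2)
      obtain K' where "regular_arrow n G K'" by auto
      then show ?thesis using classically_linked_refl by blast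
    next
      case absent: False
      obtain M where "M \<in> letters G" "M \<noteq> 1" using \<open>\<not> letters G \<subseteq> {1}\<close> by auto
      moreover from this have "1 < M" using letters_bounds[OF G(1)] by (metis atLeastAtMost_iff le_neq_implies_less subset_iff)
      ultimately show ?thesis
        using regular_arrow_absent[OF G(1) assms(1) absent _ _ highest_move_factor[OF G(1) assms(1) HG(2)]] by blast
    qed
    then obtain K K' where K: "classically_linked n G K" "regular_arrow n K K'" by blast
    have tK: "is_tensor n K" "map length K = \<mu>" "energy n K = energy n H"
      using classically_linked_same[OF K(1) G(1) assms(1)] G by (auto simp: same_energy_rows_def)
    obtain p where p: "step n 0 K p K'" and e: "energy n K' = energy n K + 1"
      using K(2) by (auto simp: regular_arrow_def)
    have n0: "0 < n" using assms(1) by simp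
    have K': "K' \<in> row_tensors n \<mu>"
      using step_tensor[OF p tK(1) n0] tK(2) by (simp add: row_tensors_iff)
    have "energy n K' \<le> Max (energy n ` row_tensors n \<mu>)"
      using K' finite_row_tensors by (intro Max_ge) auto
    then have "Max (energy n ` row_tensors n \<mu>) - energy n K' < Max (energy n ` row_tensors n \<mu>) - energy n H"
      using e tK(3) by simp
    note IH = less.hyps[OF this K']
    have "regular_edge n K K'" using tK(1) n0 p e by (auto simp: regular_edge_def)
    with IH classically_linked_regular[OF HG(1)] classically_linked_regular[OF K(1)] show ?thesis
      by (meson equivclp_trans r_into_equivclp)
  qed
qed

lemma linked_reachable:
  assumes "2 \<le> n" "equivclp (regular_edge n) H H'" "H \<in> row_tensors n \<mu>"
  shows "H' \<in> row_tensors n \<mu> \<and> H \<rightarrow>\<^sup>*\<^bsub>mk_symmetric (regular_subgraph n \<mu>)\<^esub> H'"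
  using assms(2) unfolding equivclp_def
proof (induction rule: rtranclp_induct)
  let ?S = "mk_symmetric (regular_subgraph n \<mu>)"
  have verts: "verts (regular_subgraph n \<mu>) = row_tensors n \<mu>"
    by (simp add: regular_subgraph_def crystal_graph_def)
  {
    case base
    show ?case using assms(3) by (simp add: reachable_def verts)
  next
    case (step G G')
    have edge: "K \<in> row_tensors n \<mu> \<longleftrightarrow> K' \<in> row_tensors n \<mu>"
      "K \<in> row_tensors n \<mu> \<Longrightarrow> {(K, K'), (K', K)} \<subseteq> parcs ?S"
      if e: "regular_edge n K K'" for K K'
    proof -
      obtain i p where i: "is_tensor n K" "i < n" "step n i K p K'" "i = 0 \<longrightarrow> energy n K' = energy n K + 1"
        using e by (auto simp: regular_edge_def)
      show "K \<in> row_tensors n \<mu> \<longleftrightarrow> K' \<in> row_tensors n \<mu>"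
        using i(1) step_tensor[OF i(3,1,2)] by (auto simp: row_tensors_iff)
      assume "K \<in> row_tensors n \<mu>"
      then have "(K, i, K') \<in> arcs (regular_subgraph n \<mu>)"
        using i crystal_f_acts[OF i(1) assms(1) i(2,3)] by (simp add: regular_subgraph_def crystal_graph_def)
      then show "{(K, K'), (K', K)} \<subseteq> parcs ?S"
        unfolding parcs_mk_symmetric by (force simp: regular_subgraph_def crystal_graph_def)
    qed
    have "G' \<in> row_tensors n \<mu> \<and> (G, G') \<in> parcs ?S"
      using step.hyps(2) edge[of G G'] edge[of G' G] step.IH by (auto simp: symclp_def)
    with step.IH show ?case
      by (auto simp: reachable_def verts intro: rtrancl_on_into_rtrancl_on)
  }
qed

theorem theorem5p24:
  fixes n :: nat and \<mu> :: "nat list"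
  assumes "n \<ge> 2"
    and "n \<ge> length (filter (\<lambda>m. m \<noteq> 0) \<mu>)"
  shows "connected (regular_subgraph n \<mu>)"
proof -
  let ?U = "map (\<lambda>m. replicate m 1) \<mu>"
  have verts: "verts (regular_subgraph n \<mu>) = row_tensors n \<mu>"
    by (simp add: regular_subgraph_def crystal_graph_def)
  have U: "?U \<in> row_tensors n \<mu>"
    using assms(1) by (auto simp: row_tensors_iff is_tensor_def is_row_def o_def)
  have "H \<rightarrow>\<^sup>*\<^bsub>mk_symmetric (regular_subgraph n \<mu>)\<^esub> H'" if "H \<in> row_tensors n \<mu>" "H' \<in> row_tensors n \<mu>" for H H'
  proof -
    have "equivclp (regular_edge n) H ?U" "equivclp (regular_edge n) H' ?U"
      using linked_to_single_row[OF assms] that by auto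
    then have "equivclp (regular_edge n) H H'"
      by (meson equivclp_sym equivclp_trans)
    with linked_reachable[OF assms(1) _ that(1)] show ?thesis by blast
  qed
  with U show ?thesis unfolding connected_def strongly_connected_def by (auto simp: verts)
qed

end
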